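(* Let $\alpha\in[0,1)$ and let $$\beta(\alpha):=\frac{\Gamma(\frac12)\,\Gamma(2-\alpha)}{\Gamma(\frac32-\alpha)}.$$ Suppose that $f\in\mathcal S^*(\alpha)$, i.e. $f$ is starlike of order $\alpha$ in the unit disk $\mathbb D$. Then $$|f(re^{i\theta})|^{-1}\,\ell(r,\theta)\le \beta(\alpha)\quad\text{for every } r\in(0,1)\text{ and every }\theta\in\mathbb R,$$ where $\ell(r,\theta):=\int_0^r |f'(\rho e^{i\theta})|\,d\rho$. Furthermore, the constant $\beta(\alpha)$ is optimal: for each $\alpha\in[0,1)$, it cannot be replaced by any smaller constant for which the inequality holds for all $f\in\mathcal S^*(\alpha)$, all $r\in(0,1)$ and all $\theta$.
   Context: $\mathbb D=\{z\in\mathbb C:|z|<1\}$. $\mathcal S$ is the class of functions $f$ that are regular (holomorphic) and univalent (injective) in $\mathbb D$ with $f(0)=0$ and $f'(0)=1$. For $\alpha\in[0,1)$, $\mathcal S^*(\alpha)\subset\mathcal S$ is the class of functions starlike of order $\alpha$, i.e. those $f\in\mathcal S$ with $\mathrm{Re}\left(\frac{zf'(z)}{f(z)}\right)>\alpha$ for $|z|<1$ (the quotient $zf'(z)/f(z)$ is taken to be $1$ at $z=0$). $\Gamma$ is the Euler gamma function. *)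

theory Defs
  imports "HOL-Analysis.Analysis"
begin

(* Functions in these classes are total on the complex plane; only their values on the open unit
   disk matter (deriv f z, for z in the disk, depends only on those values). *)

definition class_S :: "(complex \<Rightarrow> complex) set" where
  "class_S = {f. f holomorphic_on ball 0 1 \<and> inj_on f (ball 0 1) \<and> f 0 = 0 \<and> deriv f 0 = 1}"

(* The singularity of z * f'(z) / f(z) at 0 is removed explicitly, since 0 / 0 = 0 in HOL. *)

definition starlike_quotient :: "(complex \<Rightarrow> complex) \<Rightarrow> complex \<Rightarrow> complex" where
  "starlike_quotient f z = (if z = 0 then 1 else z * deriv f z / f z)"

definition starlike_of_order :: "real \<Rightarrow> (complex \<Rightarrow> complex) set" where
  "starlike_of_order \<alpha> = {f \<in> class_S. \<forall>z \<in> ball 0 1. Re (starlike_quotient f z) > \<alpha>}"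

definition radial_length :: "(complex \<Rightarrow> complex) \<Rightarrow> real \<Rightarrow> real \<Rightarrow> real" where
  "radial_length f r \<theta> = integral {0..r} (\<lambda>\<rho>. norm (deriv f (rcis \<rho> \<theta>)))"

definition starlike_beta :: "real \<Rightarrow> real" where
  "starlike_beta \<alpha> = Gamma (1 / 2) * Gamma (2 - \<alpha>) / Gamma (3 / 2 - \<alpha>)"

end

(*
With a = 1 - alpha, p = z f'/f = alpha + a q, where q has positive real part and q(0) = 1. On a ray
(rotated to the positive reals and rescaled to a slightly smaller disk), the Schwarz formula writes
q(rho) as the average of (1 + rho w)/(1 - rho w) over the circle |w| = 1 against a density u.
The length L and the modulus E = |f| satisfy rho L' = E |p| and rho E' = E Re p.  Put
N = |1 - rho w|^2, kappa = 1 - (1 - rho)^2/N and B(rho) = average of F(kappa), where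
F(x) = F(1/2, a; a+1; x) solves x F' + a F = a (1 - x)^(-1/2), increases from F(0) = 1, and tends
to beta(alpha) at 1. The differential equation gives
  rho B' = a * average of ((1 + rho)/sqrt N - F(kappa) (1 - rho^2)/N).
The first term dominates |q|; since F(kappa) decreases where the Poisson kernel (1 - rho^2)/N
increases, Chebyshev's inequality bounds the second one by B Re q. Hence B E - L is nondecreasing and
L <= B E <= beta(alpha) E.

For sharpness take z/(1-z)^(2a) on the ray of argument theta with 2 (1 - cos theta) = delta^2, up to
rho = 1 - eta delta, and let first delta and then eta tend to 0.
*)
theory Submission
  imports Defs "HOL-Complex_Analysis.Cauchy_Integral_Formula"
begin

subsection \<open>A hypergeometric function\<close>

definition invsqrt_coeff :: "nat \<Rightarrow> real" where
  "invsqrt_coeff n = pochhammer (1 / 2) n / fact n"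

lemma invsqrt_coeff_nonneg: "0 \<le> invsqrt_coeff n"
  by (simp add: invsqrt_coeff_def pochhammer_nonneg)

lemma invsqrt_sums:
  fixes x :: real
  assumes "\<bar>x\<bar> < 1"
  shows "(\<lambda>n. invsqrt_coeff n * x ^ n) sums ((1 - x) powr (-1/2))"
proof -
  have "(\<lambda>n. ((-1/2) gchoose n) * (-x) ^ n) sums ((1 + (-x)) powr (-1/2))"
    by (rule gen_binomial_real) (use assms in simp)
  \<comment> \<open>The sign (-1)^n in the generalized binomial coefficient cancels against the one
    in (-x)^n.\<close>
  moreover have "((-1/2::real) gchoose n) * (-x) ^ n = invsqrt_coeff n * x ^ n" for n
  proof -
    have "(-1) ^ n * (-x) ^ n = x ^ n"
      by (simp flip: power_mult_distrib)
    then show ?thesis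
      by (simp add: gbinomial_pochhammer invsqrt_coeff_def)
  qed
  ultimately show ?thesis by simp
qed

text \<open>The series with these coefficients is \<open>F(1/2, a; a + 1; x)\<close>.\<close>

definition hyp_coeff :: "real \<Rightarrow> nat \<Rightarrow> real" where
  "hyp_coeff a n = a / (a + n) * invsqrt_coeff n"

definition hyp :: "real \<Rightarrow> real \<Rightarrow> real" where
  "hyp a x = (\<Sum>n. hyp_coeff a n * x ^ n)"

definition hyp_deriv :: "real \<Rightarrow> real \<Rightarrow> real" where
  "hyp_deriv a x = (\<Sum>n. diffs (hyp_coeff a) n * x ^ n)"

context
  fixes a :: real
  assumes a: "0 < a"
begin

lemma hyp_coeff_nonneg: "0 \<le> hyp_coeff a n"
  using a by (simp add: hyp_coeff_def invsqrt_coeff_nonneg)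

lemma hyp_coeff_le: "hyp_coeff a n \<le> invsqrt_coeff n"
  using a mult_right_mono[of "a / (a + n)" 1, OF _ invsqrt_coeff_nonneg[of n]]
  by (simp add: hyp_coeff_def)

lemma summable_hyp:
  assumes "norm x < (1::real)"
  shows "summable (\<lambda>n. hyp_coeff a n * x ^ n)"
proof (rule summable_comparison_test')
  show "summable (\<lambda>n. invsqrt_coeff n * \<bar>x\<bar> ^ n)"
    using invsqrt_sums[of "\<bar>x\<bar>"] assms by (simp add: sums_iff)
  show "norm (hyp_coeff a n * x ^ n) \<le> invsqrt_coeff n * \<bar>x\<bar> ^ n" for n
    using hyp_coeff_nonneg hyp_coeff_le
    by (auto simp: abs_mult power_abs intro!: mult_right_mono)
qed

lemma hyp_has_real_derivative:
  assumes "\<bar>x\<bar> < 1"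
  shows "(hyp a has_real_derivative hyp_deriv a x) (at x)"
  unfolding hyp_def[abs_def] hyp_deriv_def
  by (rule termdiffs_strong'[where K = 1]) (use summable_hyp assms in auto)

text \<open>The operator x d/dx multiplies the n-th coefficient by n, so the left-hand side
  multiplies it by a + n. This cancels the denominator in \<open>hyp_coeff\<close> and leaves a
  times the binomial series.\<close>

lemma hyp_ode:
  assumes "\<bar>x\<bar> < 1"
  shows "x * hyp_deriv a x + a * hyp a x = a * (1 - x) powr (-1/2)"
proof -
  have "(\<lambda>n. hyp_coeff a n * x ^ n) sums hyp a x"
    unfolding hyp_def by (rule summable_sums, rule summable_hyp) (use assms in simp)
  then have 1: "(\<lambda>n. a * (hyp_coeff a n * x ^ n)) sums (a * hyp a x)"
    by (rule sums_mult)
  have "summable (\<lambda>n. diffs (hyp_coeff a) n * x ^ n)"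
    by (rule termdiff_converges[where K = 1]) (use summable_hyp assms in auto)
  then have "(\<lambda>n. diffs (hyp_coeff a) n * x ^ n) sums hyp_deriv a x"
    unfolding hyp_deriv_def by (rule summable_sums)
  then have "(\<lambda>n. x * (diffs (hyp_coeff a) n * x ^ n)) sums (x * hyp_deriv a x)"
    by (rule sums_mult)
  then have "(\<lambda>n. Suc n * hyp_coeff a (Suc n) * x ^ Suc n) sums (x * hyp_deriv a x)"
    by (simp add: diffs_def mult_ac)
  \<comment> \<open>The term of index 0 carries the factor n = 0, so the index shift adds
    nothing.\<close>
  then have 2: "(\<lambda>n. n * hyp_coeff a n * x ^ n) sums (x * hyp_deriv a x)"
    by (subst (asm) sums_Suc_iff) simp
  have "n * hyp_coeff a n * x ^ n + a * (hyp_coeff a n * x ^ n) = a * (invsqrt_coeff n * x ^ n)" for n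
  proof -
    have "n * hyp_coeff a n * x ^ n + a * (hyp_coeff a n * x ^ n) = (a + n) * hyp_coeff a n * x ^ n"
      by (simp add: algebra_simps)
    also have "(a + n) * hyp_coeff a n = a * invsqrt_coeff n"
      using a by (simp add: hyp_coeff_def)
    finally show ?thesis by simp
  qed
  then have "(\<lambda>n. a * (invsqrt_coeff n * x ^ n)) sums (x * hyp_deriv a x + a * hyp a x)"
    using sums_add[OF 2 1] by simp
  then show ?thesis
    using sums_mult[OF invsqrt_sums[OF assms], of a] sums_unique2 by blast
qed

lemma continuous_on_hyp: "continuous_on {-1<..<1} (hyp a)"
  by (rule DERIV_continuous_on[where D = "hyp_deriv a"])
     (auto intro!: has_field_derivative_at_within hyp_has_real_derivative)

text \<open>Supplies the joint continuity needed to differentiate under the integral sign in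
  \<open>hyp_average_has_real_derivative\<close>; the power series is differentiated a second
  time.\<close>

lemma continuous_on_hyp_deriv: "continuous_on {-1<..<1} (hyp_deriv a)"
proof (rule DERIV_continuous_on)
  fix x :: real
  assume "x \<in> {-1<..<1}"
  then have "(hyp_deriv a has_real_derivative (\<Sum>n. diffs (diffs (hyp_coeff a)) n * x ^ n)) (at x)"
    unfolding hyp_deriv_def[abs_def]
    by (intro termdiffs_strong'[where K = 1] termdiff_converges[where K = 1] summable_hyp) auto
  then show "(hyp_deriv a has_real_derivative (\<Sum>n. diffs (diffs (hyp_coeff a)) n * x ^ n))
      (at x within {-1<..<1})"
    by (rule has_field_derivative_at_within)
qed

text \<open>All coefficients are nonnegative, so the series can be compared term by term.\<close>

lemma hyp_mono:
  assumes "0 \<le> x" "x \<le> y" "y < 1"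
  shows "hyp a x \<le> hyp a y"
  unfolding hyp_def
  by (intro suminf_le summable_hyp mult_left_mono power_mono hyp_coeff_nonneg) (use assms in auto)

lemma hyp_0: "hyp a 0 = 1"
  unfolding hyp_def using a powser_zero[of "hyp_coeff a"]
  by (simp add: hyp_coeff_def invsqrt_coeff_def)

lemma hyp_ge_1: "0 \<le> x \<Longrightarrow> x < 1 \<Longrightarrow> 1 \<le> hyp a x"
  using hyp_mono[of 0 x] hyp_0 by simp

text \<open>x^(a - 1) is an integrating factor of the equation in \<open>hyp_ode\<close>.\<close>

lemma powr_mult_hyp_has_real_derivative:
  assumes "0 < x" "x < 1"
  shows "((\<lambda>x. x powr a * hyp a x) has_real_derivative a * x powr (a - 1) * (1 - x) powr (-1/2)) (at x)"
proof -
  have "((\<lambda>t. t powr a * hyp a t) has_real_derivative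
      a * x powr (a - 1) * hyp a x + hyp_deriv a x * x powr a) (at x)"
    using assms by (intro DERIV_mult hyp_has_real_derivative has_real_derivative_powr) auto
  moreover have "a * x powr (a - 1) * hyp a x + hyp_deriv a x * x powr a
      = x powr (a - 1) * (x * hyp_deriv a x + a * hyp a x)"
    using assms by (simp add: powr_diff field_simps)
  ultimately show ?thesis
    using hyp_ode[of x] assms by (simp add: mult_ac)
qed

text \<open>The right-hand side is an incomplete Beta integral, which makes the limit at 1
  computable. The exponent is left as 1/2 - 1 to match the Beta integral with parameters a and
  1/2.\<close>

lemma powr_mult_hyp_eq_integral:
  assumes "0 \<le> x" "x < 1"
  shows "x powr a * hyp a x = a * integral {0..x} (\<lambda>t. t powr (a - 1) * (1 - t) powr (1/2 - 1))"
proof -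
  have "((\<lambda>t. a * (t powr (a - 1) * (1 - t) powr (1/2 - 1))) has_integral
      x powr a * hyp a x - 0 powr a * hyp a 0) {0..x}"
  \<comment> \<open>For a < 1 the integrand is unbounded at 0, so derivatives are taken only in the
    interior; at 0 continuity suffices, and the boundary term vanishes because
    \<open>0 powr a = 0\<close>.\<close>
  proof (rule fundamental_theorem_of_calculus_interior)
    show "continuous_on {0..x} (\<lambda>t. t powr a * hyp a t)"
      using assms a
      by (intro continuous_intros continuous_on_powr' continuous_on_subset[OF continuous_on_hyp]) auto
    fix t
    assume t: "t \<in> {0<..<x}"
    then show "((\<lambda>t. t powr a * hyp a t) has_vector_derivative
        a * (t powr (a - 1) * (1 - t) powr (1/2 - 1))) (at t)"
      using powr_mult_hyp_has_real_derivative[of t] assms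
      by (simp add: has_real_derivative_iff_has_vector_derivative mult_ac)
  qed (use assms in auto)
  from integral_unique[OF this] show ?thesis by simp
qed

lemma powr_mult_hyp_tendsto:
  "((\<lambda>x. x powr a * hyp a x) \<longlongrightarrow> starlike_beta (1 - a)) (at_left 1)"
proof -
  let ?g = "\<lambda>t::real. t powr (a - 1) * (1 - t) powr (1/2 - 1)"
  have I: "(?g has_integral Beta a (1/2)) {0..1}"
    by (rule has_integral_Beta_real) (use a in auto)
  have "continuous_on {0..1} (\<lambda>x. a * integral {0..x} ?g)"
    by (intro continuous_intros indefinite_integral_continuous_1 has_integral_integrable[OF I])
  then have "((\<lambda>x. a * integral {0..x} ?g) \<longlongrightarrow> a * integral {0..1} ?g) (at 1 within {0..1})"
    by (simp add: continuous_on_def)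
  then have L: "((\<lambda>x. a * integral {0..x} ?g) \<longlongrightarrow> a * Beta a (1/2)) (at_left 1)"
    by (simp only: integral_unique[OF I] at_within_Icc_at_left zero_less_one)
  \<comment> \<open>a Gamma(a) = Gamma(a + 1) = Gamma(2 - alpha) and Gamma(a + 1/2) = Gamma(3/2 -
    alpha) for alpha = 1 - a.\<close>
  have beta: "a * Beta a (1/2) = starlike_beta (1 - a)"
  proof -
    have "a \<notin> \<int>\<^sub>\<le>\<^sub>0"
      using a nonpos_Ints_nonpos[of a] by auto
    then have "a * Gamma a = Gamma (a + 1)"
      using Gamma_plus1[of a] by simp
    then show ?thesis
      by (simp add: Beta_def starlike_beta_def add.commute[of a] flip: mult.assoc)
  qed
  have ev: "eventually (\<lambda>x. a * integral {0..x} ?g = x powr a * hyp a x) (at_left 1)"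
    using eventually_at_left_real[OF zero_less_one]
    by eventually_elim (subst powr_mult_hyp_eq_integral, auto)
  show ?thesis
    using Lim_transform_eventually[OF L ev] unfolding beta .
qed

text \<open>For x < y < 1 monotonicity gives y^a F(x) <= y^a F(y); let y tend to 1. Keeping the
  factor y^a on both sides makes the previous limit directly applicable.\<close>

lemma hyp_le_starlike_beta:
  assumes "0 \<le> x" "x < 1"
  shows "hyp a x \<le> starlike_beta (1 - a)"
proof (rule tendsto_le[OF _ powr_mult_hyp_tendsto])
  show "((\<lambda>y. y powr a * hyp a x) \<longlongrightarrow> hyp a x) (at_left 1)"
    by (rule tendsto_eq_intros refl | simp)+
  show "eventually (\<lambda>y. y powr a * hyp a x \<le> y powr a * hyp a y) (at_left 1)"
    using eventually_at_left_real[OF assms(2)]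
    by eventually_elim (use assms in \<open>auto intro!: mult_left_mono hyp_mono\<close>)
qed simp

end

subsection \<open>The Schwarz integral formula\<close>

lemma Cauchy_integral_cis:
  fixes q :: "complex \<Rightarrow> complex"
  assumes "continuous_on (cball 0 1) q" "q holomorphic_on ball 0 1" "norm z < 1"
  shows "((\<lambda>t. q (cis t) * cis t / (cis t - z)) has_integral 2 * pi * q z) {0..2*pi}"
proof -
  have "((\<lambda>u. q u / (u - z)) has_contour_integral (2 * of_real pi * \<i> * q z)) (circlepath 0 1)"
    by (rule Cauchy_integral_circlepath) (use assms in auto)
  then have "((\<lambda>t. q (cis t) / (cis t - z) * \<i> * cis t) has_integral (2 * of_real pi * \<i> * q z)) {0..2*pi}"
    by (simp add: circlepath_def has_contour_integral_part_circlepath_iff)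
  from has_integral_mult_right[OF this, of "-\<i>"] show ?thesis
    by (simp add: mult_ac)
qed

text \<open>Write Re q as half the sum of q and its conjugate. The part with q is Cauchy's formula
  at z and at 0; the part with the conjugate of q is the conjugate of a Cauchy integral over a
  function holomorphic in the disk.\<close>

lemma Schwarz_integral_formula:
  fixes q :: "complex \<Rightarrow> complex"
  assumes cont: "continuous_on (cball 0 1) q" and hol: "q holomorphic_on ball 0 1"
    and q0: "Im (q 0) = 0" and z: "norm z < 1"
  shows "((\<lambda>t. Re (q (cis t)) * ((cis t + z) / (cis t - z))) has_integral 2 * pi * q z) {0..2*pi}"
proof -
  \<comment> \<open>The pole at z is reflected in the unit circle: on |w| = 1 the conjugate of h(w)
    is cnj(q(w)) z/(w - z), while h is holomorphic in the disk and h(0) = 0, so its mean over the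
    circle is 0.\<close>
  define h where "h w = q w * w * cnj z / (1 - cnj z * w)" for w
  have nz: "1 - cnj z * w \<noteq> 0" if "norm w \<le> 1" for w
  proof
    assume "1 - cnj z * w = 0"
    then have "norm (cnj z * w) = 1" by simp
    moreover have "norm (cnj z * w) \<le> norm z * 1"
      unfolding norm_mult complex_mod_cnj by (intro mult_left_mono that) simp
    ultimately show False using z by simp
  qed
  have 1: "((\<lambda>t. q (cis t) * cis t / (cis t - z)) has_integral 2 * pi * q z) {0..2*pi}"
    by (rule Cauchy_integral_cis) (use assms in auto)
  have 2: "((\<lambda>t. q (cis t)) has_integral 2 * pi * q 0) {0..2*pi}"
    using Cauchy_integral_cis[OF cont hol, of 0] by simp
  have "((\<lambda>t. h (cis t) * cis t / (cis t - 0)) has_integral 2 * pi * h 0) {0..2*pi}"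
    unfolding h_def
    by (rule Cauchy_integral_cis)
       (use nz in \<open>auto intro!: continuous_intros holomorphic_intros cont hol\<close>)
  then have 3: "((\<lambda>t. cnj (h (cis t))) has_integral 0) {0..2*pi}"
    using has_integral_cnj[of "\<lambda>t. h (cis t)" 0] by (simp add: h_def o_def)
  \<comment> \<open>As q(0) is real, q and its conjugate have the same mean, and these two means
    cancel in the combination below.\<close>
  have 4: "((\<lambda>t. cnj (q (cis t))) has_integral 2 * pi * q 0) {0..2*pi}"
  proof -
    have "cnj (q 0) = q 0" by (simp add: complex_eq_iff q0)
    then show ?thesis
      using 2 has_integral_cnj[of "\<lambda>t. q (cis t)" "2 * pi * q 0"] by (simp add: o_def)
  qed
  have "((\<lambda>t. (q (cis t) * cis t / (cis t - z) - (1/2) * q (cis t))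
      + ((1/2) * cnj (q (cis t)) + cnj (h (cis t)))) has_integral
      ((2 * pi * q z - (1/2) * (2 * pi * q 0)) + ((1/2) * (2 * pi * q 0) + 0))) {0..2*pi}"
    by (intro has_integral_add has_integral_diff has_integral_mult_right 1 2 3 4)
  moreover have "(q (cis t) * cis t / (cis t - z) - (1/2) * q (cis t))
      + ((1/2) * cnj (q (cis t)) + cnj (h (cis t)))
      = Re (q (cis t)) * ((cis t + z) / (cis t - z))" for t
  proof -
    have ne: "cis t - z \<noteq> 0" using z by auto
    have "cnj (h (cis t)) = cnj (q (cis t)) * z * (cnj (cis t) / (1 - z * cnj (cis t)))"
      by (simp add: h_def)
    also have "cnj (cis t) / (1 - z * cnj (cis t)) = 1 / (cis t - z)"
    proof -
      have "1 - z * cnj (cis t) \<noteq> 0"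
        using nz[of "cis t"] by (metis complex_cnj_cnj complex_cnj_diff complex_cnj_mult
            complex_cnj_one complex_cnj_zero_iff norm_cis order_refl)
      moreover have "cnj (cis t) * cis t = 1"
        by (simp add: cis_cnj cis_mult)
      ultimately show ?thesis using ne by (simp add: field_simps)
    qed
    finally have h: "cnj (h (cis t)) = cnj (q (cis t)) * z / (cis t - z)" by simp
    have re: "complex_of_real (Re (q (cis t))) = (q (cis t) + cnj (q (cis t))) / 2"
      by (simp add: complex_add_cnj)
    define d where "d = z / (cis t - z)"
    have "q (cis t) * cis t / (cis t - z) = q (cis t) * (1 + d)"
      and "cnj (h (cis t)) = cnj (q (cis t)) * d"
      and "(cis t + z) / (cis t - z) = 1 + 2 * d"
      using ne by (simp_all add: h d_def field_simps)
    then show ?thesis unfolding re by (simp add: algebra_simps)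
  qed
  ultimately show ?thesis by simp
qed

subsection \<open>Comparison along a ray\<close>

text \<open>With f0 the mean of f for the probability density u, the product (phi(f) - phi(f0)) (f0
  - f) is nonnegative pointwise because phi is decreasing; integrating it against u gives the claim
  without a double integral.\<close>

lemma Chebyshev_integral_inequality:
  fixes u f g \<phi> :: "real \<Rightarrow> real"
  assumes cont: "continuous_on {x..y} u" "continuous_on {x..y} f" "continuous_on {x..y} (\<lambda>t. \<phi> (f t))"
    and u: "\<And>t. t \<in> {x..y} \<Longrightarrow> 0 \<le> u t" "integral {x..y} u = 1"
    and f: "\<And>t. t \<in> {x..y} \<Longrightarrow> f t \<in> {l..h}"
    and anti: "\<And>v w. l \<le> v \<Longrightarrow> v \<le> w \<Longrightarrow> w \<le> h \<Longrightarrow> \<phi> w \<le> \<phi> v"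
  shows "integral {x..y} (\<lambda>t. u t * \<phi> (f t) * f t)
    \<le> integral {x..y} (\<lambda>t. u t * \<phi> (f t)) * integral {x..y} (\<lambda>t. u t * f t)"
proof -
  note int = integrable_continuous_interval continuous_intros cont
  define f0 where "f0 = integral {x..y} (\<lambda>t. u t * f t)"
  have "integral {x..y} (\<lambda>t. u t * l) \<le> f0"
    unfolding f0_def
    by (rule integral_le, (intro int)+) (use u f in \<open>auto intro!: mult_left_mono\<close>)
  moreover have "f0 \<le> integral {x..y} (\<lambda>t. u t * h)"
    unfolding f0_def
    by (rule integral_le, (intro int)+) (use u f in \<open>auto intro!: mult_left_mono\<close>)
  \<comment> \<open>The mean stays in [l, h], the only range where phi is known to be
    decreasing.\<close>
  ultimately have f0: "l \<le> f0" "f0 \<le> h" using u(2) by simp_all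
  have "0 \<le> integral {x..y} (\<lambda>t. u t * ((\<phi> (f t) - \<phi> f0) * (f0 - f t)))"
  proof (rule integral_nonneg)
    fix t assume t: "t \<in> {x..y}"
    have "0 \<le> (\<phi> (f t) - \<phi> f0) * (f0 - f t)"
    proof (cases "f t \<le> f0")
      case True
      then show ?thesis using anti[of "f t" f0] f[OF t] f0 by simp
    next
      case False
      then show ?thesis using anti[of f0 "f t"] f[OF t] f0
        by (intro mult_nonpos_nonpos) auto
    qed
    then show "0 \<le> u t * ((\<phi> (f t) - \<phi> f0) * (f0 - f t))" using u(1)[OF t] by simp
  qed (intro int)
  \<comment> \<open>The last two terms cancel after integration, since u has mass 1 and u f has
    integral f0.\<close>
  also have "(\<lambda>t. u t * ((\<phi> (f t) - \<phi> f0) * (f0 - f t)))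
      = (\<lambda>t. (u t * \<phi> (f t)) * f0 - u t * \<phi> (f t) * f t - \<phi> f0 * (u t * f0) + \<phi> f0 * (u t * f t))"
    by (simp add: algebra_simps)
  also have "integral {x..y} \<dots> = integral {x..y} (\<lambda>t. u t * \<phi> (f t)) * f0
      - integral {x..y} (\<lambda>t. u t * \<phi> (f t) * f t) - \<phi> f0 * f0 + \<phi> f0 * f0"
  proof -
    have 1: "(\<lambda>t. u t * \<phi> (f t)) integrable_on {x..y}"
      and 2: "(\<lambda>t. u t * \<phi> (f t) * f t) integrable_on {x..y}"
      and 3: "(\<lambda>t. u t * f t) integrable_on {x..y}"
      and 4: "u integrable_on {x..y}"
      by (intro int)+
    have "((\<lambda>t. (u t * \<phi> (f t)) * f0 - u t * \<phi> (f t) * f t - \<phi> f0 * (u t * f0) + \<phi> f0 * (u t * f t))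
      has_integral (integral {x..y} (\<lambda>t. u t * \<phi> (f t)) * f0
        - integral {x..y} (\<lambda>t. u t * \<phi> (f t) * f t) - \<phi> f0 * (1 * f0) + \<phi> f0 * f0)) {x..y}"
      unfolding f0_def u(2)[symmetric]
      by (intro has_integral_add has_integral_diff has_integral_mult_left has_integral_mult_right
            integrable_integral 1 2 3 4)
    then show ?thesis by (simp add: integral_unique)
  qed
  finally show ?thesis by (simp add: f0_def)
qed

section \<open>The Herglotz kernel and the variable kappa at a point of the ray\<close>

text \<open>This is N of the overview, for w the conjugate of \<open>cis t\<close>. It is given as a
  polynomial in rho and cos t, so that it can be differentiated in rho without a norm.\<close>

definition circ_dist2 :: "real \<Rightarrow> real \<Rightarrow> real" where
  "circ_dist2 \<rho> t = 1 - 2 * \<rho> * cos t + \<rho>\<^sup>2"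

lemma circ_dist2_eq_norm: "circ_dist2 \<rho> t = (norm (cis t - of_real \<rho>))\<^sup>2"
  by (simp add: cmod_power2 circ_dist2_def power2_diff sin_squared_eq algebra_simps)

lemma circ_dist2_lower:
  assumes "0 \<le> \<rho>"
  shows "(1 - \<rho>)\<^sup>2 \<le> circ_dist2 \<rho> t"
  using mult_left_mono[of "cos t" 1 \<rho>] assms by (simp add: circ_dist2_def power2_eq_square algebra_simps)

lemma circ_dist2_upper:
  assumes "0 \<le> \<rho>" 
  shows "circ_dist2 \<rho> t \<le> (1 + \<rho>)\<^sup>2"
  using mult_left_mono[of "-1" "cos t" \<rho>] assms by (simp add: circ_dist2_def power2_eq_square algebra_simps)

lemma circ_dist2_pos:
  assumes "0 \<le> \<rho>" "\<rho> < 1"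
  shows "0 < circ_dist2 \<rho> t"
  using circ_dist2_lower[OF assms(1), of t] assms by (smt (verit) zero_less_power2)

lemma continuous_on_circ_dist2 [continuous_intros]:
  fixes f g :: "'a::t2_space \<Rightarrow> real"
  shows "continuous_on A f \<Longrightarrow> continuous_on A g \<Longrightarrow> continuous_on A (\<lambda>x. circ_dist2 (f x) (g x))"
  unfolding circ_dist2_def by (intro continuous_intros)

lemma Re_Herglotz_kernel:
  "Re ((cis t + of_real \<rho>) / (cis t - of_real \<rho>)) = (1 - \<rho>\<^sup>2) / circ_dist2 \<rho> t"
proof -
  have "(cos t + \<rho>) * (cos t - \<rho>) + sin t * sin t = 1 - \<rho>\<^sup>2"
    using sin_cos_squared_add[of t] by (simp add: power2_eq_square algebra_simps)
  then show ?thesis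
    by (simp add: Re_divide' circ_dist2_eq_norm)
qed

text \<open>Only the numerator is estimated, with equality at t = 0 where the kernel is largest. The
  bound is the first term of the derivative in \<open>hyp_circ_arg_derivative_eq\<close>.\<close>

lemma norm_Herglotz_kernel_le:
  assumes "0 \<le> \<rho>"
  shows "norm ((cis t + of_real \<rho>) / (cis t - of_real \<rho>)) \<le> (1 + \<rho>) / sqrt (circ_dist2 \<rho> t)"
  using norm_triangle_ineq[of "cis t" "of_real \<rho>"] assms
  by (simp add: norm_divide circ_dist2_eq_norm divide_right_mono)

text \<open>
  The variable called kappa above; it equals \<open>T\<^sup>2 / (1 + T\<^sup>2)\<close> with
  \<open>T = 2 sqrt \<rho> sin (t/2) / (1 - \<rho>)\<close>.
\<close>

definition circ_arg :: "real \<Rightarrow> real \<Rightarrow> real" where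
  "circ_arg \<rho> t = 1 - (1 - \<rho>)\<^sup>2 / circ_dist2 \<rho> t"

lemma circ_arg_bounds:
  assumes "0 \<le> \<rho>" "\<rho> < 1"
  shows "0 \<le> circ_arg \<rho> t" "circ_arg \<rho> t < 1"
  using circ_dist2_lower[OF assms(1), of t] circ_dist2_pos[OF assms, of t] assms
  by (simp_all add: circ_arg_def)

lemma continuous_on_circ_arg [continuous_intros]:
  fixes f g :: "'a::t2_space \<Rightarrow> real"
  assumes "continuous_on A f" "continuous_on A g" "\<And>x. x \<in> A \<Longrightarrow> 0 \<le> f x \<and> f x < 1"
  shows "continuous_on A (\<lambda>x. circ_arg (f x) (g x))"
  unfolding circ_arg_def
  by (intro continuous_intros assms) (use circ_dist2_pos assms(3) in \<open>metis less_irrefl\<close>)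

lemma circ_arg_has_real_derivative:
  assumes "0 \<le> \<rho>" "\<rho> < 1"
  shows "((\<lambda>\<rho>. circ_arg \<rho> t) has_real_derivative
    2 * (1 - cos t) * (1 - \<rho>\<^sup>2) / (circ_dist2 \<rho> t)\<^sup>2) (at \<rho>)"
proof -
  have nz: "1 - 2 * \<rho> * cos t + \<rho>\<^sup>2 \<noteq> 0"
    using circ_dist2_pos[OF assms, of t] by (simp add: circ_dist2_def)
  show ?thesis unfolding circ_arg_def circ_dist2_def
    by (rule derivative_eq_intros refl nz | simp)+
       (use nz in \<open>simp add: power2_eq_square algebra_simps minus_divide_left del: divide_minus_left\<close>)
qed

text \<open>Since N - (1 - rho)^2 = 2 rho (1 - cos t), rho times the derivative of kappa is kappa P
  with P = (1 - rho^2)/N the Poisson kernel. So rho dF(kappa)/drho = kappa F'(kappa) P, and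
  \<open>hyp_ode\<close> eliminates F'. Here (1 - kappa)^(-1/2) = sqrt N/(1 - rho), which P turns
  into (1 + rho)/sqrt N.\<close>

lemma hyp_circ_arg_derivative_eq:
  assumes a: "0 < a" and \<rho>: "0 < \<rho>" "\<rho> < 1"
  shows "\<rho> * (hyp_deriv a (circ_arg \<rho> t) * (2 * (1 - cos t) * (1 - \<rho>\<^sup>2) / (circ_dist2 \<rho> t)\<^sup>2))
    = a * ((1 + \<rho>) / sqrt (circ_dist2 \<rho> t) - (1 - \<rho>\<^sup>2) / circ_dist2 \<rho> t * hyp a (circ_arg \<rho> t))"
proof -
  define N where "N = circ_dist2 \<rho> t"
  define \<kappa> where "\<kappa> = circ_arg \<rho> t"
  have N: "0 < N" unfolding N_def by (rule circ_dist2_pos) (use \<rho> in auto)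
  have \<kappa>: "0 \<le> \<kappa>" "\<kappa> < 1"
    using circ_arg_bounds[of \<rho> t] \<rho> by (auto simp: \<kappa>_def)
  have \<kappa>_eq: "\<kappa> = 2 * \<rho> * (1 - cos t) / N"
    using N unfolding \<kappa>_def circ_arg_def N_def[symmetric]
    by (simp add: field_simps) (simp add: N_def circ_dist2_def power2_eq_square algebra_simps)
  have "\<rho> * (hyp_deriv a \<kappa> * (2 * (1 - cos t) * (1 - \<rho>\<^sup>2) / N\<^sup>2)) = \<kappa> * hyp_deriv a \<kappa> * ((1 - \<rho>\<^sup>2) / N)"
    by (simp add: \<kappa>_eq power2_eq_square)
  also have "\<kappa> * hyp_deriv a \<kappa> = a * (1 - \<kappa>) powr (-1/2) - a * hyp a \<kappa>"
    using hyp_ode[OF a, of \<kappa>] \<kappa> by simp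
  also have "(1 - \<kappa>) powr (-1/2) = sqrt N / (1 - \<rho>)"
  proof -
    have "1 - \<kappa> = ((1 - \<rho>) / sqrt N)\<^sup>2"
      using N by (simp add: \<kappa>_def circ_arg_def N_def power_divide)
    moreover have "0 < (1 - \<rho>) / sqrt N"
      using N \<rho> by simp
    ultimately show ?thesis
      using N \<rho> by (simp add: powr_minus_divide powr_half_sqrt)
  qed
  also have "(a * (sqrt N / (1 - \<rho>)) - a * hyp a \<kappa>) * ((1 - \<rho>\<^sup>2) / N)
      = a * ((1 + \<rho>) * (sqrt N / N) - (1 - \<rho>\<^sup>2) / N * hyp a \<kappa>)"
  proof -
    have "1 - \<rho>\<^sup>2 = (1 - \<rho>) * (1 + \<rho>)"
      by (simp add: power2_eq_square algebra_simps)
    then have key: "(sqrt N / (1 - \<rho>)) * ((1 - \<rho>\<^sup>2) / N) = (1 + \<rho>) * (sqrt N / N)"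
      using \<rho> by simp
    have alg: "(a * v - a * h) * x = a * (v * x - x * h)" for v h x :: real
      by (simp add: algebra_simps)
    show ?thesis unfolding key[symmetric] by (rule alg)
  qed
  also have "sqrt N / N = 1 / sqrt N"
    using N by (simp add: real_div_sqrt field_simps)
  finally show ?thesis by (simp add: N_def \<kappa>_def)
qed

lemma hyp_average_has_real_derivative:
  assumes a: "0 < a" and u: "continuous_on {0..2*pi} u" and \<rho>: "0 < \<rho>" "\<rho> < 1"
  shows "((\<lambda>\<rho>. integral {0..2*pi} (\<lambda>t. u t * hyp a (circ_arg \<rho> t))) has_real_derivative
    integral {0..2*pi} (\<lambda>t. u t * (hyp_deriv a (circ_arg \<rho> t)
      * (2 * (1 - cos t) * (1 - \<rho>\<^sup>2) / (circ_dist2 \<rho> t)\<^sup>2)))) (at \<rho>)"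
proof -
  \<comment> \<open>An open parameter set, so that the derivative within it is the full derivative;
    on it kappa stays in [0, 1), inside the disk of convergence.\<close>
  let ?U = "{0<..<1::real}"
  have "((\<lambda>\<rho>. integral (cbox 0 (2*pi)) (\<lambda>t. u t * hyp a (circ_arg \<rho> t))) has_real_derivative
    integral (cbox 0 (2*pi)) (\<lambda>t. u t * (hyp_deriv a (circ_arg \<rho> t)
      * (2 * (1 - cos t) * (1 - \<rho>\<^sup>2) / (circ_dist2 \<rho> t)\<^sup>2)))) (at \<rho> within ?U)"
  proof (rule leibniz_rule_field_derivative)
    fix x t :: real
    assume x: "x \<in> ?U"
    have "((\<lambda>\<rho>. hyp a (circ_arg \<rho> t)) has_real_derivative
        hyp_deriv a (circ_arg x t) * (2 * (1 - cos t) * (1 - x\<^sup>2) / (circ_dist2 x t)\<^sup>2)) (at x)"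
      by (rule DERIV_chain2[OF hyp_has_real_derivative[OF a] circ_arg_has_real_derivative])
         (use circ_arg_bounds[of x t] x in auto)
    then show "((\<lambda>\<rho>. u t * hyp a (circ_arg \<rho> t)) has_real_derivative
        u t * (hyp_deriv a (circ_arg x t) * (2 * (1 - cos t) * (1 - x\<^sup>2) / (circ_dist2 x t)\<^sup>2)))
        (at x within ?U)"
      by (rule has_field_derivative_at_within[OF DERIV_cmult])
  next
    fix x :: real
    assume x: "x \<in> ?U"
    have "circ_arg x t \<in> {-1<..<1}" for t
      using circ_arg_bounds[of x t] x by auto
    then show "(\<lambda>t. u t * hyp a (circ_arg x t)) integrable_on cbox 0 (2*pi)"
      unfolding cbox_interval using x
      by (intro integrable_continuous_interval continuous_intros u
            continuous_on_compose2[OF continuous_on_hyp[OF a]]) auto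
  next
    have "circ_arg x t \<in> {-1<..<1}" if "x \<in> ?U" for x t
      using circ_arg_bounds[of x t] that by auto
    moreover have "circ_dist2 x t \<noteq> 0" if "x \<in> ?U" for x t
      using circ_dist2_pos[of x t] that by auto
    ultimately show "continuous_on (?U \<times> cbox 0 (2*pi)) (\<lambda>(x, t). u t * (hyp_deriv a (circ_arg x t)
        * (2 * (1 - cos t) * (1 - x\<^sup>2) / (circ_dist2 x t)\<^sup>2)))"
      unfolding case_prod_unfold
      by (intro continuous_intros continuous_on_compose2[OF u]
            continuous_on_compose2[OF continuous_on_hyp_deriv[OF a]]) auto
  qed (use \<rho> in auto)
  then show ?thesis
    using \<rho> by (simp add: at_within_open[of \<rho> ?U])
qed

section \<open>The differential comparison of length and modulus\<close>

text \<open>The upper bound freed from function theory: E and L stand for modulus and length and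
  enter only through their values at 0 and their differential equations in terms of p = alpha + (1 -
  alpha) q. The averages B lie between 1 and beta(alpha); both bounds are used.\<close>

lemma length_le_of_Herglotz:
  fixes u E L :: "real \<Rightarrow> real" and q :: "real \<Rightarrow> complex"
  assumes \<alpha>: "0 \<le> \<alpha>" "\<alpha> < 1"
    and u_cont: "continuous_on {0..2*pi} u" and u_nonneg: "\<And>t. 0 \<le> u t"
    and u_int: "integral {0..2*pi} u = 1"
    and q: "\<And>\<rho>. 0 < \<rho> \<Longrightarrow> \<rho> < 1 \<Longrightarrow>
      ((\<lambda>t. u t * ((cis t + of_real \<rho>) / (cis t - of_real \<rho>))) has_integral q \<rho>) {0..2*pi}"
    and s: "0 < s" "s < 1"
    and cont: "continuous_on {0..s} E" "continuous_on {0..s} L"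
    and E0: "E 0 = 0" and L0: "L 0 = 0"
    and Epos: "\<And>\<rho>. 0 < \<rho> \<Longrightarrow> \<rho> \<le> s \<Longrightarrow> 0 < E \<rho>"
    and E': "\<And>\<rho>. 0 < \<rho> \<Longrightarrow> \<rho> < s \<Longrightarrow>
      (E has_real_derivative E \<rho> * Re (of_real \<alpha> + of_real (1 - \<alpha>) * q \<rho>) / \<rho>) (at \<rho>)"
    and L': "\<And>\<rho>. 0 < \<rho> \<Longrightarrow> \<rho> < s \<Longrightarrow>
      (L has_real_derivative E \<rho> * norm (of_real \<alpha> + of_real (1 - \<alpha>) * q \<rho>) / \<rho>) (at \<rho>)"
  shows "L s \<le> starlike_beta \<alpha> * E s"
proof -
  define a where "a = 1 - \<alpha>"
  have a: "0 < a" using \<alpha> by (simp add: a_def)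
  define B where "B \<rho> = integral {0..2*pi} (\<lambda>t. u t * hyp a (circ_arg \<rho> t))" for \<rho>
  have cont_hyp: "continuous_on {0..2*pi} (\<lambda>t. hyp a (circ_arg \<rho> t))" if "0 \<le> \<rho>" "\<rho> < 1" for \<rho>
  proof -
    have "circ_arg \<rho> t \<in> {-1<..<1}" for t
      using circ_arg_bounds[OF that, of t] by auto
    then show ?thesis using that
      by (intro continuous_intros continuous_on_compose2[OF continuous_on_hyp[OF a]]) auto
  qed
  have int_hyp: "(\<lambda>t. u t * hyp a (circ_arg \<rho> t)) integrable_on {0..2*pi}" if "0 \<le> \<rho>" "\<rho> < 1" for \<rho>
    by (intro integrable_continuous_interval continuous_on_mult u_cont cont_hyp that)
  have B_ge: "1 \<le> B \<rho>" if "0 \<le> \<rho>" "\<rho> < 1" for \<rho>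
  proof -
    have "integral {0..2*pi} (\<lambda>t. u t * 1) \<le> B \<rho>"
      unfolding B_def
      by (intro integral_le int_hyp mult_left_mono hyp_ge_1 a circ_arg_bounds that u_nonneg)
         (simp add: integrable_continuous_interval u_cont)
    then show ?thesis using u_int by simp
  qed
  have B_le: "B \<rho> \<le> starlike_beta \<alpha>" if "0 \<le> \<rho>" "\<rho> < 1" for \<rho>
  proof -
    have "B \<rho> \<le> integral {0..2*pi} (\<lambda>t. u t * starlike_beta (1 - a))"
      unfolding B_def
      by (intro integral_le int_hyp mult_left_mono hyp_le_starlike_beta a circ_arg_bounds that u_nonneg
            integrable_continuous_interval continuous_intros u_cont)
    then show ?thesis using u_int by (simp add: a_def)
  qed
  have B_cont: "continuous_on {0..s} B"
  proof -
    have "circ_arg x t \<in> {-1<..<1}" if "x \<in> {0..s}" for x t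
      using circ_arg_bounds[of x t] that s by auto
    then have "continuous_on ({0..s} \<times> cbox 0 (2*pi)) (\<lambda>(\<rho>, t). u t * hyp a (circ_arg \<rho> t))"
      unfolding case_prod_unfold using s
      by (intro continuous_intros continuous_on_compose2[OF u_cont]
            continuous_on_compose2[OF continuous_on_hyp[OF a]]) auto
    then show ?thesis
      unfolding B_def using integral_continuous_on_param by fastforce
  qed
  have "B 0 * E 0 - L 0 \<le> B s * E s - L s"
  \<comment> \<open>The equations contain the factor 1/rho and are available only strictly between 0
    and s; continuity takes care of the endpoints.\<close>
  proof (rule DERIV_nonneg_imp_increasing_open[where f = "\<lambda>x. B x * E x - L x"])
    fix \<rho> assume \<rho>: "0 < \<rho>" "\<rho> < s"
    with s have \<rho>1: "0 \<le> \<rho>" "\<rho> < 1" by auto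
    let ?N = "circ_dist2 \<rho>" and ?H = "\<lambda>t. hyp a (circ_arg \<rho> t)"
    have N: "0 < ?N t" for t by (rule circ_dist2_pos[OF \<rho>1])
    have N': "?N t \<noteq> 0" for t using N[of t] by simp
    define P where "P t = (1 - \<rho>\<^sup>2) / ?N t" for t
    define S where "S t = (1 + \<rho>) / sqrt (?N t)" for t
    have cont_P: "continuous_on {0..2*pi} P" and cont_S: "continuous_on {0..2*pi} S"
      unfolding P_def S_def using N' by (auto intro!: continuous_intros)
    note int = integrable_continuous_interval continuous_on_mult u_cont cont_P cont_S cont_hyp[OF \<rho>1]
    have "((\<lambda>t. Re (u t * ((cis t + of_real \<rho>) / (cis t - of_real \<rho>)))) has_integral Re (q \<rho>)) {0..2*pi}"
      by (rule has_integral_Re[OF q]) (use \<rho> \<rho>1 in auto)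
    moreover have "Re (u t * ((cis t + of_real \<rho>) / (cis t - of_real \<rho>))) = u t * P t" for t
      unfolding P_def Re_Herglotz_kernel[symmetric]
      by (simp only: times_complex.sel Re_complex_of_real Im_complex_of_real mult_zero_left diff_zero)
    ultimately have Re_q: "Re (q \<rho>) = integral {0..2*pi} (\<lambda>t. u t * P t)"
      by (simp add: integral_unique)
    have "norm (integral {0..2*pi} (\<lambda>t. u t * ((cis t + of_real \<rho>) / (cis t - of_real \<rho>))))
        \<le> integral {0..2*pi} (\<lambda>t. u t * S t)"
    proof (rule integral_norm_bound_integral)
      show "(\<lambda>t. u t * ((cis t + of_real \<rho>) / (cis t - of_real \<rho>))) integrable_on {0..2*pi}"
        using q[of \<rho>] \<rho> \<rho>1 by blast
      show "norm (u t * ((cis t + of_real \<rho>) / (cis t - of_real \<rho>))) \<le> u t * S t" for t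
        unfolding S_def norm_mult norm_of_real abs_of_nonneg[OF u_nonneg]
        by (rule mult_left_mono[OF norm_Herglotz_kernel_le[OF \<rho>1(1)] u_nonneg])
    qed (intro int)
    then have norm_q: "norm (q \<rho>) \<le> integral {0..2*pi} (\<lambda>t. u t * S t)"
      using q[of \<rho>] \<rho> \<rho>1 by (simp add: integral_unique)
    \<comment> \<open>The Poisson kernel is c m with m = 1 - kappa in (0, 1], so that F(kappa) = F(1
      - m) is a decreasing function of m and Chebyshev's inequality applies to m.\<close>
    define c where "c = (1 + \<rho>) / (1 - \<rho>)"
    define m where "m t = (1 - \<rho>)\<^sup>2 / ?N t" for t
    have Pm: "P t = c * m t" for t
      using \<rho> \<rho>1 N'[of t] by (simp add: P_def m_def c_def field_simps power2_eq_square)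
    have cov: "integral {0..2*pi} (\<lambda>t. u t * ?H t * P t) \<le> B \<rho> * Re (q \<rho>)"
    proof -
      have "integral {0..2*pi} (\<lambda>t. u t * hyp a (1 - m t) * m t)
          \<le> integral {0..2*pi} (\<lambda>t. u t * hyp a (1 - m t)) * integral {0..2*pi} (\<lambda>t. u t * m t)"
      \<comment> \<open>The lower end l comes from N <= (1 + rho)^2. It is positive, which keeps the
        argument 1 - w below 1.\<close>
      proof (rule Chebyshev_integral_inequality[where l = "(1 - \<rho>)\<^sup>2 / (1 + \<rho>)\<^sup>2" and h = 1 and \<phi> = "\<lambda>w. hyp a (1 - w)"])
        show "continuous_on {0..2*pi} m"
          unfolding m_def using N' by (auto intro!: continuous_intros)
        show "continuous_on {0..2*pi} (\<lambda>t. hyp a (1 - m t))"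
          using cont_hyp[OF \<rho>1] by (simp add: m_def circ_arg_def)
        show "m t \<in> {(1 - \<rho>)\<^sup>2 / (1 + \<rho>)\<^sup>2..1}" for t
          using N[of t] circ_dist2_lower[OF \<rho>1(1), of t] circ_dist2_upper[OF \<rho>1(1), of t]
            \<rho>
          by (auto simp: m_def intro!: divide_left_mono)
        show "hyp a (1 - w) \<le> hyp a (1 - v)"
          if "(1 - \<rho>)\<^sup>2 / (1 + \<rho>)\<^sup>2 \<le> v" "v \<le> w" "w \<le> 1" for v w
        proof -
          have "0 < (1 - \<rho>)\<^sup>2 / (1 + \<rho>)\<^sup>2" using \<rho> \<rho>1 by simp
          then show ?thesis using that by (intro hyp_mono a) linarith+
        qed
      qed (use u_cont u_nonneg u_int in auto)
      then have "c * integral {0..2*pi} (\<lambda>t. u t * ?H t * m t) \<le> c * (B \<rho> * integral {0..2*pi} (\<lambda>t. u t * m t))"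
        unfolding B_def circ_arg_def m_def using \<rho> \<rho>1 by (intro mult_left_mono) (auto simp: c_def)
      then show ?thesis
        unfolding Re_q Pm by (simp add: mult_ac)
    qed
    let ?B' = "integral {0..2*pi} (\<lambda>t. u t * (hyp_deriv a (circ_arg \<rho> t)
      * (2 * (1 - cos t) * (1 - \<rho>\<^sup>2) / (circ_dist2 \<rho> t)\<^sup>2)))"
    have "\<rho> * ?B' = integral {0..2*pi} (\<lambda>t. \<rho> * (u t * (hyp_deriv a (circ_arg \<rho> t)
      * (2 * (1 - cos t) * (1 - \<rho>\<^sup>2) / (circ_dist2 \<rho> t)\<^sup>2))))"
      by (rule integral_mult_right[symmetric])
    also have "\<dots> = integral {0..2*pi} (\<lambda>t. a * (u t * S t - u t * ?H t * P t))"
    proof (rule integral_cong)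
      fix t
      have "\<rho> * (u t * (hyp_deriv a (circ_arg \<rho> t)
          * (2 * (1 - cos t) * (1 - \<rho>\<^sup>2) / (circ_dist2 \<rho> t)\<^sup>2))) = u t * (a * (S t - P t * ?H t))"
        unfolding S_def P_def hyp_circ_arg_derivative_eq[OF a \<rho>(1) \<rho>1(2), symmetric]
        by (rule mult.left_commute)
      also have "\<dots> = a * (u t * S t - u t * ?H t * P t)"
        by (simp add: algebra_simps)
      finally show "\<rho> * (u t * (hyp_deriv a (circ_arg \<rho> t)
          * (2 * (1 - cos t) * (1 - \<rho>\<^sup>2) / (circ_dist2 \<rho> t)\<^sup>2))) = \<dots>" .
    qed
    also have "\<dots> = a * (integral {0..2*pi} (\<lambda>t. u t * S t) - integral {0..2*pi} (\<lambda>t. u t * ?H t * P t))"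
    proof -
      have "(\<lambda>t. u t * S t) integrable_on {0..2*pi}" "(\<lambda>t. u t * ?H t * P t) integrable_on {0..2*pi}"
        by (intro int)+
      then show ?thesis by (simp add: integral_diff)
    qed
    finally have B': "a * (norm (q \<rho>) - B \<rho> * Re (q \<rho>)) \<le> \<rho> * ?B'"
      using norm_q cov a by simp
    define b where "b = ?B'"
    have B'_b: "a * norm (q \<rho>) - a * (B \<rho> * Re (q \<rho>)) \<le> \<rho> * b"
      using B' unfolding b_def[symmetric] by (simp only: right_diff_distrib)
    define p where "p = of_real \<alpha> + of_real (1 - \<alpha>) * q \<rho>"
    have p_eq: "p = of_real \<alpha> + of_real a * q \<rho>"
      by (simp add: a_def p_def)
    have norm_p: "norm p \<le> \<alpha> + a * norm (q \<rho>)"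
      unfolding p_eq
      using norm_triangle_ineq[of "of_real \<alpha>" "of_real a * q \<rho>"] \<alpha> a by (simp add: norm_mult)
    have "B \<rho> * Re p = \<alpha> * B \<rho> + a * (B \<rho> * Re (q \<rho>))"
      unfolding p_eq by (simp add: algebra_simps)
    \<comment> \<open>The summand alpha of p contributes at most alpha to |p| but alpha B to B Re p;
      this is where B >= 1 enters.\<close>
    moreover have "\<alpha> * 1 \<le> \<alpha> * B \<rho>"
      using B_ge[OF \<rho>1] \<alpha> by (intro mult_left_mono) auto
    ultimately have nonneg: "0 \<le> \<rho> * b + B \<rho> * Re p - norm p"
      using B'_b norm_p by linarith
    have "((\<lambda>x. B x * E x - L x) has_real_derivative
        b * E \<rho> + E \<rho> * Re p / \<rho> * B \<rho> - E \<rho> * norm p / \<rho>) (at \<rho>)"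
      unfolding B_def b_def p_def
      by (intro DERIV_diff DERIV_mult E' L' \<rho> hyp_average_has_real_derivative a u_cont \<rho>1)
    moreover have "b * E \<rho> + E \<rho> * Re p / \<rho> * B \<rho> - E \<rho> * norm p / \<rho>
        = E \<rho> / \<rho> * (\<rho> * b + B \<rho> * Re p - norm p)"
      using \<rho> by (simp add: field_simps)
    moreover have "0 \<le> E \<rho> / \<rho> * (\<rho> * b + B \<rho> * Re p - norm p)"
      using nonneg Epos[of \<rho>] \<rho> by (intro mult_nonneg_nonneg) auto
    ultimately show "\<exists>y. ((\<lambda>x. B x * E x - L x) has_real_derivative y) (at \<rho>) \<and> 0 \<le> y"
      by metis
  qed (use s in \<open>auto intro!: continuous_intros cont B_cont\<close>)
  then have "L s \<le> B s * E s" by (simp add: E0 L0)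
  also have "\<dots> \<le> starlike_beta \<alpha> * E s"
    using B_le[of s] Epos[of s] s by (intro mult_right_mono) auto
  finally show ?thesis .
qed

section \<open>The upper bound for starlike functions\<close>

text \<open>f(z)/z extends holomorphically over 0 and has no zeros by injectivity; the quotient is
  f' divided by this extension.\<close>

lemma holomorphic_on_starlike_quotient:
  assumes "f \<in> class_S"
  shows "starlike_quotient f holomorphic_on ball 0 1"
proof -
  from assms have f: "f holomorphic_on ball 0 1" "inj_on f (ball 0 1)" "f 0 = 0" "deriv f 0 = 1"
    by (auto simp: class_S_def)
  define h where "h z = (if z = 0 then 1 else f z / z)" for z
  have "h holomorphic_on ball 0 1"
    by (rule pole_theorem_open_0[OF f(1), of 0]) (auto simp: h_def f)
  moreover have "h z \<noteq> 0" if "z \<in> ball 0 1" for z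
    using inj_onD[OF f(2), of z 0] that f by (auto simp: h_def)
  ultimately have "(\<lambda>z. deriv f z / h z) holomorphic_on ball 0 1"
    by (intro holomorphic_intros f) auto
  then show ?thesis
    by (rule holomorphic_transform) (auto simp: h_def starlike_quotient_def f)
qed

text \<open>This is the real part of the logarithmic derivative, computed through the gradient
  \<open>sgn\<close> of the norm so that no branch of the logarithm has to be chosen.\<close>

lemma norm_has_real_derivative:
  fixes \<gamma> :: "real \<Rightarrow> complex"
  assumes "(\<gamma> has_vector_derivative \<gamma>') (at x)" "\<gamma> x \<noteq> 0"
  shows "((\<lambda>x. norm (\<gamma> x)) has_real_derivative norm (\<gamma> x) * Re (\<gamma>' / \<gamma> x)) (at x)"
proof -
  have "((\<lambda>x. norm (\<gamma> x)) has_derivative (\<lambda>h. (h *\<^sub>R \<gamma>') \<bullet> sgn (\<gamma> x))) (at x)"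
    using has_derivative_compose[OF assms(1)[unfolded has_vector_derivative_def]
        has_derivative_norm[OF assms(2)]] by (simp add: inner_commute)
  moreover have "\<gamma>' \<bullet> sgn (\<gamma> x) = norm (\<gamma> x) * Re (\<gamma>' / \<gamma> x)"
    using assms(2) by (simp add: sgn_div_norm Re_divide' inner_complex_def field_simps power2_eq_square)
  ultimately show ?thesis
    by (simp add: has_field_derivative_def mult.commute[of _ "norm (\<gamma> x) * _"])
qed

lemma radial_length_le:
  assumes \<alpha>: "0 \<le> \<alpha>" "\<alpha> < 1" and f: "f \<in> starlike_of_order \<alpha>" and r: "0 < r" "r < 1"
  shows "radial_length f r \<theta> \<le> starlike_beta \<alpha> * norm (f (rcis r \<theta>))"
proof -
  from f have fS: "f \<in> class_S" and hol: "f holomorphic_on ball 0 1"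
    and inj: "inj_on f (ball 0 1)" and f0: "f 0 = 0"
    and Re: "\<And>z. z \<in> ball 0 1 \<Longrightarrow> \<alpha> < Re (starlike_quotient f z)"
    by (auto simp: starlike_of_order_def class_S_def)
  have f_nz: "f z \<noteq> 0" if "z \<in> ball 0 1" "z \<noteq> 0" for z
    using inj_onD[OF inj, of z 0] that f0 by auto
  \<comment> \<open>Any radius strictly between r and 1 would do. Scaling by R makes q holomorphic
    on the closed disk, so that its boundary density is continuous, and r becomes s = r/R <
    1.\<close>
  define R where "R = (1 + r) / 2"
  have R: "0 < R" "R < 1" "r < R" using r by (auto simp: R_def)
  define c where "c = rcis R \<theta>"
  have c: "norm c = R" "c \<noteq> 0" and c_mult: "c * of_real x = rcis (R * x) \<theta>" for x
    using R by (auto simp: c_def rcis_def norm_mult)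
  have c_ball: "c * z \<in> ball 0 1" if "norm z \<le> 1" for z
  proof -
    have "R * norm z \<le> R * 1" using R by (intro mult_left_mono that) auto
    then have "R * norm z < 1" using R by linarith
    then show ?thesis using c by (simp add: norm_mult)
  qed
  define a where "a = 1 - \<alpha>"
  have a: "0 < a" and a_eq: "1 - complex_of_real \<alpha> = of_real a" using \<alpha> by (simp_all add: a_def)
  define q where "q z = (starlike_quotient f (c * z) - \<alpha>) / a" for z
  have q_hol: "q holomorphic_on cball 0 1"
    unfolding q_def using a
    by (intro holomorphic_intros holomorphic_on_compose_gen[OF _ holomorphic_on_starlike_quotient[OF fS],
          unfolded o_def]) (auto intro: c_ball)
  have q0: "q 0 = 1"
    using a by (simp add: q_def starlike_quotient_def a_eq)
  have q_pos: "0 < Re (q z)" if "norm z \<le> 1" for z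
    using Re[OF c_ball[OF that]] a by (simp add: q_def)
  have p_eq: "of_real \<alpha> + of_real (1 - \<alpha>) * q z = starlike_quotient f (c * z)" for z
    using a by (simp add: q_def a_eq)
  \<comment> \<open>The Herglotz density of q. Its mass is Re q(0) = 1, read off from the Schwarz
    formula at z = 0, where the kernel is 1.\<close>
  define u where "u t = Re (q (cis t)) / (2 * pi)" for t
  have Schwarz: "((\<lambda>t. u t * ((cis t + z) / (cis t - z))) has_integral q z) {0..2*pi}" if "norm z < 1" for z
  proof -
    have "((\<lambda>t. Re (q (cis t)) * ((cis t + z) / (cis t - z))) has_integral 2 * pi * q z) {0..2*pi}"
      by (rule Schwarz_integral_formula)
         (use that q_hol q0 in \<open>auto intro: holomorphic_on_imp_continuous_on holomorphic_on_subset\<close>)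
    from has_integral_mult_right[OF this, of "1 / (2 * pi)"] show ?thesis
      by (simp add: u_def)
  qed
  have u_int: "integral {0..2*pi} u = 1"
    using has_integral_Re[OF Schwarz[of 0]] q0 by (simp add: integral_unique)
  have u_cont: "continuous_on {0..2*pi} u"
    unfolding u_def
    by (intro continuous_intros continuous_on_compose2[OF holomorphic_on_imp_continuous_on[OF q_hol]]) auto
  define g where "g x = norm (deriv f (rcis x \<theta>))" for x
  have g_cont: "continuous_on {0..r} g"
    unfolding g_def
    by (intro continuous_intros continuous_on_compose2[OF holomorphic_on_imp_continuous_on[OF holomorphic_deriv[OF hol]]])
       (use r in \<open>auto simp: rcis_def norm_mult intro!: continuous_intros\<close>)
  define s where "s = r / R"
  have s: "0 < s" "s < 1" "R * s = r" using r R by (auto simp: s_def)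
  have Rx: "R * x \<in> {0..r}" if "x \<in> {0..s}" for x
  proof -
    have "R * x \<le> R * s" using that R by (intro mult_left_mono) auto
    then have "R * x \<le> r" using s by linarith
    then show ?thesis using that R by simp
  qed
  define E where "E x = norm (f (c * of_real x))" for x :: real
  \<comment> \<open>Length is measured on the unscaled ray. Since rho d/drho is invariant under
    scaling, E and L satisfy the equations required by the comparison.\<close>
  define L where "L x = integral {0..R * x} g" for x :: real
  have "L s \<le> starlike_beta \<alpha> * E s"
  proof (rule length_le_of_Herglotz[OF \<alpha> u_cont _ u_int _ s(1,2), where q = "\<lambda>\<rho>. q (of_real \<rho>)"])
    show "0 \<le> u t" for t using q_pos[of "cis t"] by (simp add: u_def)
    show "((\<lambda>t. u t * ((cis t + of_real \<rho>) / (cis t - of_real \<rho>))) has_integral q (of_real \<rho>)) {0..2*pi}"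
      if "0 < \<rho>" "\<rho> < 1" for \<rho>
      by (rule Schwarz) (use that in auto)
    show "continuous_on {0..s} E"
      unfolding E_def
      by (intro continuous_intros continuous_on_compose2[OF holomorphic_on_imp_continuous_on[OF hol]])
         (use s in \<open>auto simp del: mem_ball intro!: c_ball\<close>)
    show "continuous_on {0..s} L"
      unfolding L_def
      by (rule continuous_on_compose2[OF indefinite_integral_continuous_1[OF integrable_continuous_interval[OF g_cont]]])
         (use Rx in \<open>auto intro!: continuous_intros simp del: atLeastAtMost_iff\<close>)
    show "E 0 = 0" "L 0 = 0" by (simp_all add: E_def L_def f0)
    have nz: "f (c * of_real \<rho>) \<noteq> 0" if "0 < \<rho>" "\<rho> \<le> s" for \<rho> :: real
      by (rule f_nz[OF c_ball]) (use that s c in auto)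
    then show "0 < E \<rho>" if "0 < \<rho>" "\<rho> \<le> s" for \<rho>
      using that by (simp add: E_def)
    fix \<rho> :: real
    assume \<rho>: "0 < \<rho>" "\<rho> < s"
    define z where "z = c * of_real \<rho>"
    have z: "z \<noteq> 0" and fz: "f z \<noteq> 0"
      unfolding z_def using \<rho> c nz[of \<rho>] by auto
    have z_ball: "z \<in> ball 0 1"
      unfolding z_def by (rule c_ball) (use \<rho> s in auto)
    have p: "of_real \<alpha> + of_real (1 - \<alpha>) * q (of_real \<rho>) = z * deriv f z / f z"
      using p_eq[of "of_real \<rho>"] z by (simp add: z_def starlike_quotient_def)
    have "((\<lambda>x. f (c * of_real x)) has_vector_derivative c * deriv f z) (at \<rho>)"
    proof -
      have "(f has_field_derivative deriv f z) (at z)"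
        using holomorphic_derivI[OF hol _ z_ball] by simp
      moreover have "((\<lambda>x. c * of_real x) has_vector_derivative c) (at \<rho>)"
        by (auto intro!: derivative_eq_intros)
      ultimately show ?thesis
        using field_vector_diff_chain_at[of "\<lambda>x. c * of_real x" c \<rho> f "deriv f z"]
        by (simp add: o_def z_def)
    qed
    then have "(E has_real_derivative norm (f z) * Re (c * deriv f z / f z)) (at \<rho>)"
      unfolding E_def[abs_def] z_def using norm_has_real_derivative nz[of \<rho>] \<rho> by fastforce
    moreover have "Re (z * deriv f z / f z) = \<rho> * Re (c * deriv f z / f z)"
    proof -
      have "z * deriv f z / f z = of_real \<rho> * (c * deriv f z / f z)"
        by (simp add: z_def)
      then show ?thesis
        by (simp only: times_complex.sel Re_complex_of_real Im_complex_of_real mult_zero_left diff_zero)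
    qed
    ultimately show "(E has_real_derivative E \<rho> * Re (of_real \<alpha> + of_real (1 - \<alpha>) * q (of_real \<rho>)) / \<rho>) (at \<rho>)"
      unfolding p using \<rho> by (simp add: E_def z_def)
    have R\<rho>: "R * \<rho> \<in> {0<..<r}"
      using \<rho> R s(3) mult_strict_left_mono[of \<rho> s R] by auto
    have "((\<lambda>x. integral {0..x} g) has_real_derivative g (R * \<rho>)) (at (R * \<rho>) within {0..r})"
      by (rule integral_has_real_derivative[OF g_cont]) (use R\<rho> in auto)
    then have "((\<lambda>x. integral {0..x} g) has_real_derivative g (R * \<rho>)) (at (R * \<rho>))"
      using R\<rho> by (simp add: at_within_Icc_at)
    moreover have "((\<lambda>x. R * x) has_real_derivative R) (at \<rho>)"
      by (auto intro!: derivative_eq_intros)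
    ultimately have "(L has_real_derivative g (R * \<rho>) * R) (at \<rho>)"
      unfolding L_def[abs_def] by (rule DERIV_chain2)
    moreover have "g (R * \<rho>) * R = E \<rho> * norm (z * deriv f z / f z) / \<rho>"
    proof -
      have "norm z = R * \<rho>" using c \<rho> by (simp add: z_def norm_mult)
      moreover have "g (R * \<rho>) = norm (deriv f z)" "E \<rho> = norm (f z)"
        by (simp_all add: g_def E_def z_def c_mult)
      ultimately show ?thesis
        using \<rho> fz by (simp add: norm_mult norm_divide)
    qed
    ultimately show "(L has_real_derivative E \<rho> * norm (of_real \<alpha> + of_real (1 - \<alpha>) * q (of_real \<rho>)) / \<rho>) (at \<rho>)"
      unfolding p by simp
  qed
  then show ?thesis
    by (simp add: L_def E_def g_def[abs_def] radial_length_def c_mult s)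
qed

subsection \<open>The extremal functions\<close>

text \<open>The Noshiro-Warschawski criterion: along the segment from w to z the real part of f/(z -
  w) has derivative Re f' > 0, so its end values differ.\<close>

lemma inj_on_Re_deriv_pos:
  assumes "convex S" and f': "\<And>z. z \<in> S \<Longrightarrow> (f has_field_derivative f' z) (at z)"
    and pos: "\<And>z. z \<in> S \<Longrightarrow> 0 < Re (f' z)"
  shows "inj_on f S"
proof (rule inj_onI, rule ccontr)
  fix z w assume zw: "z \<in> S" "w \<in> S" "f z = f w" "z \<noteq> w"
  define \<gamma> where "\<gamma> t = w + of_real t * (z - w)" for t :: real
  have \<gamma>_S: "\<gamma> t \<in> S" if "0 \<le> t" "t \<le> 1" for t
    using convexD_alt[OF assms(1) zw(2,1) that] by (simp add: \<gamma>_def scaleR_conv_of_real algebra_simps)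
  have "Re (f (\<gamma> 0) / (z - w)) < Re (f (\<gamma> 1) / (z - w))"
  proof (rule DERIV_pos_imp_increasing[of 0 1 "\<lambda>t. Re (f (\<gamma> t) / (z - w))"])
    fix t :: real assume t: "0 \<le> t" "t \<le> 1"
    have "(\<gamma> has_vector_derivative (z - w)) (at t)"
      unfolding \<gamma>_def by (auto intro!: derivative_eq_intros)
    then have "((\<lambda>t. f (\<gamma> t)) has_vector_derivative (z - w) * f' (\<gamma> t)) (at t)"
      using field_vector_diff_chain_at f'[OF \<gamma>_S[OF t]] by (fastforce simp: o_def)
    then have "((\<lambda>t. f (\<gamma> t) / (z - w)) has_vector_derivative (z - w) * f' (\<gamma> t) / (z - w)) (at t)"
      by (rule has_vector_derivative_divide)
    then have "((\<lambda>t. Re (f (\<gamma> t) / (z - w))) has_real_derivative Re (f' (\<gamma> t))) (at t)"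
      using zw(4) bounded_linear.has_vector_derivative[OF bounded_linear_Re]
      by (fastforce simp: has_real_derivative_iff_has_vector_derivative)
    then show "\<exists>y. ((\<lambda>t. Re (f (\<gamma> t) / (z - w))) has_real_derivative y) (at t) \<and> 0 < y"
      using pos[OF \<gamma>_S[OF t]] by blast
  qed simp
  then show False using zw by (simp add: \<gamma>_def)
qed

text \<open>For a = 1 this is the Koebe function. The principal power is holomorphic here because 1
  - z avoids the negative real axis and 0.\<close>

definition koebe :: "real \<Rightarrow> complex \<Rightarrow> complex" where
  "koebe a z = z * (1 - z) powr of_real (-2 * a)"

lemma one_minus_not_nonpos_Reals: "norm (z::complex) < 1 \<Longrightarrow> 1 - z \<notin> \<real>\<^sub>\<le>\<^sub>0"
  using complex_Re_le_cmod[of z] by (auto simp: complex_nonpos_Reals_iff)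

text \<open>Multiplied by |1 - z|^2 the inequality reduces to |z|^2 < 1. It serves both univalence
  and starlikeness of \<open>koebe\<close>.\<close>

lemma Re_z_div_one_minus:
  assumes "norm z < 1"
  shows "-1/2 < Re (z / (1 - z))"
proof -
  have "(Re z)\<^sup>2 + (Im z)\<^sup>2 < 1"
    using assms by (metis cmod_power2 norm_ge_zero power_less_one_iff zero_less_numeral one_power2 power_strict_mono)
  moreover have N: "(norm (1 - z))\<^sup>2 = (1 - Re z)\<^sup>2 + (Im z)\<^sup>2"
    by (simp add: cmod_power2)
  ultimately have "- 1/2 * (norm (1 - z))\<^sup>2 < Re z * (1 - Re z) - Im z * Im z"
    by (simp add: power2_eq_square algebra_simps)
  moreover have "0 < (norm (1 - z))\<^sup>2"
    using assms by auto
  ultimately show ?thesis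
    by (simp add: Re_divide' pos_less_divide_eq)
qed

text \<open>The power is factored out so that the other factor is the starlike quotient.\<close>

lemma koebe_has_field_derivative:
  assumes "norm z < 1"
  shows "(koebe a has_field_derivative
    (1 - z) powr of_real (-2 * a) * (1 + of_real (2 * a) * (z / (1 - z)))) (at z)"
proof -
  have nz: "1 - z \<noteq> 0" using assms by auto
  have "((\<lambda>z. (1 - z) powr of_real (-2 * a)) has_field_derivative
      (of_real (-2 * a) * (1 - z) powr (of_real (-2 * a) - 1)) * (-1)) (at z)"
    by (rule DERIV_chain2[OF has_field_derivative_powr])
       (use one_minus_not_nonpos_Reals[OF assms] in \<open>auto intro!: derivative_eq_intros\<close>)
  then have "(koebe a has_field_derivative 1 * (1 - z) powr of_real (-2 * a)
      + (of_real (-2 * a) * (1 - z) powr (of_real (-2 * a) - 1)) * (-1) * z) (at z)"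
    unfolding koebe_def[abs_def] by (intro DERIV_mult DERIV_ident)
  moreover have "(1 - z) powr (of_real (-2 * a) - 1) = (1 - z) powr of_real (-2 * a) / (1 - z)"
    using nz by (simp only: powr_diff powr_one' powr_to_1)
  ultimately show ?thesis
    by (simp add: algebra_simps)
qed

lemma deriv_koebe:
  "norm z < 1 \<Longrightarrow> deriv (koebe a) z =
    (1 - z) powr of_real (-2 * a) * (1 + of_real (2 * a) * (z / (1 - z)))"
  using koebe_has_field_derivative DERIV_imp_deriv by blast

text \<open>
  In the coordinate \<open>\<zeta> = Ln z\<close> the map becomes a function on the left half-plane whose derivative
  is the starlike quotient, so that univalence follows from \<open>inj_on_Re_deriv_pos\<close>.
\<close>

lemma inj_on_koebe:
  assumes a: "0 < a" "a \<le> 1"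
  shows "inj_on (koebe a) (ball 0 1)"
proof (rule inj_onI)
  fix z w assume zw: "z \<in> ball 0 1" "w \<in> ball 0 1" "koebe a z = koebe a w"
  have koebe_eq_0: "koebe a x = 0 \<longleftrightarrow> x = 0" if "x \<in> ball 0 1" for x
    using that by (auto simp: koebe_def)
  \<comment> \<open>A holomorphic logarithm of \<open>koebe a (exp \<zeta>)\<close> on the left
    half-plane.\<close>
  define l where "l \<zeta> = \<zeta> - of_real (2 * a) * Ln (1 - exp \<zeta>)" for \<zeta>
  have exp_l: "exp (l \<zeta>) = koebe a (exp \<zeta>)" if "Re \<zeta> < 0" for \<zeta>
  proof -
    have "norm (exp \<zeta>) < 1" using that by (simp add: norm_exp_eq_Re)
    then have "exp \<zeta> \<noteq> 1" by (metis norm_one less_irrefl)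
    then have "1 - exp \<zeta> \<noteq> 0" by simp
    then show ?thesis
      by (simp add: l_def koebe_def exp_diff powr_def exp_minus field_simps)
  qed
  have l_inj: "inj_on l {\<zeta>. Re \<zeta> < 0}"
  proof (rule inj_on_Re_deriv_pos)
    show "convex {\<zeta>. Re \<zeta> < 0}" by (rule convex_halfspace_Re_lt)
    fix \<zeta> assume "\<zeta> \<in> {\<zeta>. Re \<zeta> < 0}"
    then have n: "norm (exp \<zeta>) < 1" by (simp add: norm_exp_eq_Re)
    show "(l has_field_derivative 1 + of_real (2 * a) * (exp \<zeta> / (1 - exp \<zeta>))) (at \<zeta>)"
      unfolding l_def using one_minus_not_nonpos_Reals[OF n]
      by (auto intro!: derivative_eq_intros simp: divide_inverse mult_ac)
    have "0 < 1 + 2 * a * Re (exp \<zeta> / (1 - exp \<zeta>))"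
      using mult_strict_left_mono[OF Re_z_div_one_minus[OF n], of "2 * a"] a by simp
    then show "0 < Re (1 + of_real (2 * a) * (exp \<zeta> / (1 - exp \<zeta>)))"
      by (simp only: plus_complex.sel one_complex.sel times_complex.sel Re_complex_of_real
          Im_complex_of_real mult_zero_left diff_zero)
  qed
  show "z = w"
  proof (cases "z = 0 \<or> w = 0")
    case True
    then show ?thesis using zw koebe_eq_0 by metis
  next
    case False
    define \<zeta> where "\<zeta> = Ln z"
    define \<omega> where "\<omega> = Ln w"
    have \<zeta>: "exp \<zeta> = z" "Re \<zeta> < 0" and \<omega>: "exp \<omega> = w" "Re \<omega> < 0"
      using False zw by (auto simp: \<zeta>_def \<omega>_def)
    have "exp (l \<zeta>) = exp (l \<omega>)"
      using zw(3) exp_l \<zeta> \<omega> by simp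
    then obtain n :: int where n: "l \<zeta> = l \<omega> + of_int (2 * n) * pi * \<i>"
      unfolding exp_eq by blast
    \<comment> \<open>Equal values of \<open>koebe\<close> determine l only up to a multiple of 2 pi
      i. Shifting the second point by that multiple leaves its exponential unchanged and makes the
      values of l agree exactly.\<close>
    define \<omega>' where "\<omega>' = \<omega> + of_int (2 * n) * pi * \<i>"
    have exp': "exp \<omega>' = exp \<omega>"
      unfolding exp_eq \<omega>'_def by blast
    then have "l \<omega>' = l \<omega> + of_int (2 * n) * pi * \<i>"
      by (simp add: l_def \<omega>'_def)
    moreover have "Re \<omega>' < 0" using \<omega> by (simp add: \<omega>'_def)
    ultimately have "\<zeta> = \<omega>'"
      using inj_onD[OF l_inj, of \<zeta> \<omega>'] n \<zeta> by simp
    then show "z = w" using exp' \<zeta> \<omega> by simp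
  qed
qed

text \<open>The quotient is 1 + 2 a z/(1 - z), whose real part exceeds 1 - a = alpha on the
  disk.\<close>

lemma koebe_starlike:
  assumes "0 \<le> \<alpha>" "\<alpha> < 1"
  shows "koebe (1 - \<alpha>) \<in> starlike_of_order \<alpha>"
proof -
  define a where "a = 1 - \<alpha>"
  have a: "0 < a" "a \<le> 1" using assms by (auto simp: a_def)
  have "koebe a holomorphic_on ball 0 1"
    by (rule holomorphic_onI)
       (use koebe_has_field_derivative field_differentiable_at_within in \<open>force simp: field_differentiable_def\<close>)
  moreover have "\<alpha> < Re (starlike_quotient (koebe a) z)" if z: "z \<in> ball 0 1" for z
  proof (cases "z = 0")
    case True
    then show ?thesis using assms by (simp add: starlike_quotient_def)
  next
    case False
    have nz: "1 - z \<noteq> 0" using z by auto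
    have "starlike_quotient (koebe a) z = 1 + of_real (2 * a) * (z / (1 - z))"
      using False z nz by (simp add: starlike_quotient_def deriv_koebe koebe_def powr_def)
    then have "Re (starlike_quotient (koebe a) z) = 1 + 2 * a * Re (z / (1 - z))"
      by (simp only: plus_complex.sel one_complex.sel times_complex.sel Re_complex_of_real
          Im_complex_of_real mult_zero_left diff_zero)
    moreover have "- a < 2 * a * Re (z / (1 - z))"
      using mult_strict_left_mono[OF Re_z_div_one_minus, of z "2 * a"] a z by simp
    ultimately show ?thesis by (simp add: a_def)
  qed
  ultimately show ?thesis
    using inj_on_koebe[OF a] deriv_koebe[of 0 a]
    by (simp add: starlike_of_order_def class_S_def a_def koebe_def)
qed

section \<open>Lower bound for the radial length of the extremal functions\<close>

text \<open>The integrand models |f'| near the singularity 1 along a ray passing it at distance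
  about delta. The substitution kappa = delta^2/(delta^2 + (1 - rho)^2) makes it the derivative of
  x^a F(x) at kappa; for rho = 1 - y delta, kappa is 1/(1 + y^2), independent of delta.\<close>

lemma has_integral_powr_quadratic:
  fixes a \<delta> \<eta> Y :: real
  assumes a: "0 < a" and \<delta>: "0 < \<delta>" and \<eta>: "0 < \<eta>" "\<eta> \<le> Y"
  defines "\<Phi> \<equiv> \<lambda>x. x powr a * hyp a x"
  shows "((\<lambda>\<rho>. 2 * a * \<delta> powr (2 * a) * (\<delta>\<^sup>2 + (1 - \<rho>)\<^sup>2) powr (-a - 1/2)) has_integral
    (\<Phi> (1 / (1 + \<eta>\<^sup>2)) - \<Phi> (1 / (1 + Y\<^sup>2)))) {1 - Y * \<delta>..1 - \<eta> * \<delta>}"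
proof -
  define \<kappa> where "\<kappa> \<rho> = \<delta>\<^sup>2 / (\<delta>\<^sup>2 + (1 - \<rho>)\<^sup>2)" for \<rho>
  have "((\<lambda>\<rho>. 2 * a * \<delta> powr (2 * a) * (\<delta>\<^sup>2 + (1 - \<rho>)\<^sup>2) powr (-a - 1/2)) has_integral
    (\<Phi> (\<kappa> (1 - \<eta> * \<delta>)) - \<Phi> (\<kappa> (1 - Y * \<delta>)))) {1 - Y * \<delta>..1 - \<eta> * \<delta>}"
  proof (rule fundamental_theorem_of_calculus)
    show "1 - Y * \<delta> \<le> 1 - \<eta> * \<delta>" using assms by simp
    fix \<rho> assume \<rho>: "\<rho> \<in> {1 - Y * \<delta>..1 - \<eta> * \<delta>}"
    have "0 < \<eta> * \<delta>" using assms by simp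
    with \<rho> have \<rho>1: "\<rho> < 1" by auto
    define D where "D = \<delta>\<^sup>2 + (1 - \<rho>)\<^sup>2"
    have D: "0 < D" using \<delta> by (simp add: D_def add_pos_nonneg)
    have \<kappa>: "0 < \<kappa> \<rho>" "\<kappa> \<rho> < 1"
      using \<delta> \<rho>1 D by (auto simp: \<kappa>_def D_def)
    have d\<kappa>: "(\<kappa> has_real_derivative \<delta>\<^sup>2 * (2 * (1 - \<rho>)) / D\<^sup>2) (at \<rho>)"
    proof -
      have "((\<lambda>x. \<delta>\<^sup>2 + (1 - x)\<^sup>2) has_real_derivative - (2 * (1 - \<rho>))) (at \<rho>)"
        by (auto intro!: derivative_eq_intros)
      from DERIV_divide[OF DERIV_const this, of "\<delta>\<^sup>2"] less_imp_neq[OF D, symmetric]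
      have "(\<kappa> has_real_derivative (0 * D - \<delta>\<^sup>2 * - (2 * (1 - \<rho>))) / (D * D)) (at \<rho>)"
        unfolding \<kappa>_def[abs_def] D_def by blast
      then show ?thesis
        by (simp only: power2_eq_square[of D] mult_minus_right minus_minus mult_zero_left diff_0)
    qed
    have "((\<lambda>x. \<Phi> (\<kappa> x)) has_real_derivative
        (a * \<kappa> \<rho> powr (a - 1) * (1 - \<kappa> \<rho>) powr (-1/2)) * (\<delta>\<^sup>2 * (2 * (1 - \<rho>)) / D\<^sup>2)) (at \<rho>)"
      unfolding \<Phi>_def
      by (rule DERIV_chain2[OF powr_mult_hyp_has_real_derivative[OF a \<kappa>] d\<kappa>])
    moreover have "(a * \<kappa> \<rho> powr (a - 1) * (1 - \<kappa> \<rho>) powr (-1/2)) * (\<delta>\<^sup>2 * (2 * (1 - \<rho>)) / D\<^sup>2)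
        = 2 * a * \<delta> powr (2 * a) * D powr (-a - 1/2)"
    proof -
      \<comment> \<open>Every factor becomes a power of delta, v or D; adding exponents cancels v
        and leaves 2 a for delta and -a - 1/2 for D.\<close>
      define v where "v = 1 - \<rho>"
      have v: "0 < v" using \<rho>1 by (simp add: v_def)
      have "\<kappa> \<rho> = \<delta> powr 2 * D powr (-1)"
        using \<delta> D by (simp add: \<kappa>_def D_def powr_minus powr_numeral divide_inverse)
      then have 1: "\<kappa> \<rho> powr (a - 1) = \<delta> powr (2 * (a - 1)) * D powr (1 - a)"
        by (simp only: powr_mult powr_powr powr_ge_zero) simp
      have "1 - \<kappa> \<rho> = v powr 2 * D powr (-1)"
        using v D by (simp add: \<kappa>_def D_def v_def powr_minus powr_numeral field_simps)
      then have 2: "(1 - \<kappa> \<rho>) powr (-1/2) = v powr (-1) * D powr (1/2)"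
        by (simp only: powr_mult powr_powr powr_ge_zero) simp
      have 3: "\<delta>\<^sup>2 * (2 * v) / D\<^sup>2 = 2 * (\<delta> powr 2 * v powr 1 * D powr (-2))"
        using \<delta> v D by (simp add: powr_minus powr_neg_numeral powr_numeral divide_inverse)
      have "(a * (\<delta> powr (2 * (a - 1)) * D powr (1 - a)) * (v powr (-1) * D powr (1/2)))
          * (2 * (\<delta> powr 2 * v powr 1 * D powr (-2)))
          = 2 * a * (\<delta> powr (2 * (a - 1)) * \<delta> powr 2) * (v powr (-1) * v powr 1)
            * (D powr (1 - a) * D powr (1/2) * D powr (-2))"
        by (simp only: mult_ac)
      also have "\<dots> = 2 * a * \<delta> powr (2 * a) * D powr (-a - 1/2)"
      proof -
        have "2 * (a - 1) + 2 = 2 * a" "1 - a + 1/2 + -2 = -a - 1/2" by simp_all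
        then show ?thesis using v unfolding powr_add[symmetric] by (simp only:) simp
      qed
      finally show ?thesis unfolding 1 2 3[unfolded v_def] by (simp only: v_def)
    qed
    ultimately show "((\<lambda>x. \<Phi> (\<kappa> x)) has_vector_derivative
        2 * a * \<delta> powr (2 * a) * (\<delta>\<^sup>2 + (1 - \<rho>)\<^sup>2) powr (-a - 1/2))
        (at \<rho> within {1 - Y * \<delta>..1 - \<eta> * \<delta>})"
      unfolding D_def
      by (simp add: has_real_derivative_iff_has_vector_derivative has_vector_derivative_at_within)
  qed
  moreover have "\<kappa> (1 - y * \<delta>) = 1 / (1 + y\<^sup>2)" for y
  proof -
    have "\<delta>\<^sup>2 + (y * \<delta>)\<^sup>2 = \<delta>\<^sup>2 * (1 + y\<^sup>2)"
      by (simp add: power_mult_distrib algebra_simps)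
    then show ?thesis using \<delta> by (simp add: \<kappa>_def)
  qed
  ultimately show ?thesis by simp
qed

lemma norm_powr_of_real:
  "norm (w powr of_real x) = norm w powr x" if "w \<noteq> 0" for w :: complex
  using that by (simp add: powr_def)

lemma norm_one_minus_rcis: "(norm (1 - rcis \<rho> \<theta>))\<^sup>2 = circ_dist2 \<rho> \<theta>"
  by (simp add: cmod_power2 circ_dist2_def power2_diff power_mult_distrib sin_squared_eq algebra_simps)

text \<open>The angle is chosen so that 2 (1 - cos theta) = delta^2, hence |1 - z|^2 = (1 - rho)^2 +
  rho delta^2. This is at most delta^2 + (1 - rho)^2, which bounds the length below by the model
  integral, and at least rho delta^2, which at rho = r bounds 1/|f| below and produces the factor
  r^a.\<close>

lemma koebe_ray_lower_bound:
  fixes a \<delta> \<eta> Y :: real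
  assumes a: "0 < a" "a \<le> 1" and \<delta>: "0 < \<delta>" "\<delta> \<le> 2" "Y * \<delta> < 1" "\<delta> * sqrt (1 + Y\<^sup>2) \<le> 2 * a"
    and \<eta>: "0 < \<eta>" "\<eta> \<le> Y"
  defines "\<Phi> \<equiv> \<lambda>x. x powr a * hyp a x"
    and "r \<equiv> 1 - \<eta> * \<delta>" and "\<theta> \<equiv> arccos (1 - \<delta>\<^sup>2 / 2)"
  shows "(1 - \<delta> * sqrt (1 + Y\<^sup>2) / (2 * a)) * r powr a * (\<Phi> (1 / (1 + \<eta>\<^sup>2)) - \<Phi> (1 / (1 + Y\<^sup>2)))
    \<le> inverse (norm (koebe a (rcis r \<theta>))) * radial_length (koebe a) r \<theta>"
proof -
  \<comment> \<open>A lower bound for |1 + (2 a - 1) z| on the part of the ray with 1 - rho <= Y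
    delta.\<close>
  define K where "K = 2 * a - \<delta> * sqrt (1 + Y\<^sup>2)"
  define I where "I = \<Phi> (1 / (1 + \<eta>\<^sup>2)) - \<Phi> (1 / (1 + Y\<^sup>2))"
  define g where "g \<rho> = 2 * a * \<delta> powr (2 * a) * (\<delta>\<^sup>2 + (1 - \<rho>)\<^sup>2) powr (-a - 1/2)" for \<rho>
  have K: "0 \<le> K" using \<delta> by (simp add: K_def)
  have "\<delta>\<^sup>2 \<le> 2\<^sup>2" using \<delta> by (intro power_mono) auto
  then have cos_\<theta>: "cos \<theta> = 1 - \<delta>\<^sup>2 / 2"
    unfolding \<theta>_def by (intro cos_arccos) auto
  have "0 < \<eta> * \<delta>" "\<eta> * \<delta> \<le> Y * \<delta>" using \<delta> \<eta> by auto
  then have r: "0 < r" "r < 1" using \<delta>(3) unfolding r_def by linarith+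
  have dist: "circ_dist2 \<rho> \<theta> = (1 - \<rho>)\<^sup>2 + \<rho> * \<delta>\<^sup>2" for \<rho>
    unfolding circ_dist2_def cos_\<theta> by (simp add: power2_eq_square algebra_simps)
  have I: "(g has_integral I) {1 - Y * \<delta>..r}"
    unfolding g_def I_def \<Phi>_def r_def
    by (rule has_integral_powr_quadratic) (use a \<delta> \<eta> in auto)
  have rcis_lt: "norm (rcis \<rho> \<theta>) < 1" if "\<rho> \<in> {0..r}" for \<rho>
    using that r by simp
  define g' where "g' \<rho> = norm (deriv (koebe a) (rcis \<rho> \<theta>))" for \<rho>
  have cont: "continuous_on {0..r} g'"
  proof -
    have "koebe a holomorphic_on ball 0 1"
      using koebe_starlike[of "1 - a"] a by (simp add: starlike_of_order_def class_S_def)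
    then have "continuous_on (ball 0 1) (deriv (koebe a))"
      using holomorphic_on_imp_continuous_on holomorphic_deriv open_ball by blast
    moreover have "continuous_on {0..r} (\<lambda>\<rho>. rcis \<rho> \<theta>)"
      unfolding rcis_def by (intro continuous_intros)
    ultimately show ?thesis
      unfolding g'_def using rcis_lt
      by (intro continuous_on_norm, elim continuous_on_compose2) auto
  qed
  have lower: "K * \<delta> powr (-2 * a) / (2 * a) * g \<rho> \<le> g' \<rho>" if \<rho>: "\<rho> \<in> {1 - Y * \<delta>..r}" for \<rho>
  proof -
    define z where "z = rcis \<rho> \<theta>"
    have \<rho>': "0 < \<rho>" "\<rho> < 1" using \<rho> \<delta> r by auto
    have z1: "norm z < 1"
      unfolding z_def by (rule rcis_lt) (use \<rho> \<rho>' in auto)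
    then have nz: "1 - z \<noteq> 0" by auto
    define D where "D = \<delta>\<^sup>2 + (1 - \<rho>)\<^sup>2"
    have norm_le: "(norm (1 - z))\<^sup>2 \<le> D"
      unfolding z_def norm_one_minus_rcis dist D_def
      using \<rho>' mult_right_mono[of \<rho> 1 "\<delta>\<^sup>2"] by simp
    have "1 - \<rho> \<le> Y * \<delta>" using \<rho> by simp
    then have "D \<le> \<delta>\<^sup>2 + (Y * \<delta>)\<^sup>2"
      using \<rho>' unfolding D_def by (intro add_left_mono power_mono) auto
    also have "\<dots> = (\<delta> * sqrt (1 + Y\<^sup>2))\<^sup>2"
      by (simp add: power_mult_distrib algebra_simps)
    finally have "norm (1 - z) \<le> \<delta> * sqrt (1 + Y\<^sup>2)"
      using norm_le \<delta> by (auto intro: power2_le_imp_le[OF order_trans])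
    \<comment> \<open>Near z = 1 this factor of f' is close to 2 a, because |2 a - 1| <= 1.\<close>
    moreover have "norm (1 + of_real (2 * a - 1) * z) \<ge> 2 * a - norm (1 - z)"
    proof -
      have "norm (of_real (2 * a - 1) * (1 - z)) \<le> 1 * norm (1 - z)"
        unfolding norm_mult norm_of_real by (intro mult_right_mono) (use a in auto)
      moreover have "1 + of_real (2 * a - 1) * z = of_real (2 * a) - of_real (2 * a - 1) * (1 - z)"
        by (simp add: algebra_simps)
      ultimately show ?thesis
        using norm_triangle_ineq2[of "of_real (2 * a)" "of_real (2 * a - 1) * (1 - z)"] a by simp
    qed
    ultimately have K_le: "K \<le> norm (1 + of_real (2 * a - 1) * z)"
      by (simp add: K_def)
    have "1 + of_real (2 * a) * (z / (1 - z)) = (1 + of_real (2 * a - 1) * z) / (1 - z)"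
      using nz by (simp add: field_simps)
    then have "g' \<rho> = norm (1 - z) powr (-2 * a) * (norm (1 + of_real (2 * a - 1) * z) / norm (1 - z))"
      unfolding g'_def z_def[symmetric] deriv_koebe[OF z1] norm_mult norm_powr_of_real[OF nz]
      by (simp only: norm_divide)
    also have "\<dots> = norm (1 + of_real (2 * a - 1) * z) * norm (1 - z) powr (-2 * a - 1)"
      using nz by (simp add: powr_diff)
    also have "norm (1 - z) powr (-2 * a - 1) = ((norm (1 - z))\<^sup>2) powr (-a - 1/2)"
      using nz by (simp add: powr_powr algebra_simps flip: powr_numeral)
    finally have g': "g' \<rho> = norm (1 + of_real (2 * a - 1) * z) * ((norm (1 - z))\<^sup>2) powr (-a - 1/2)" .
    have "K * \<delta> powr (-2 * a) / (2 * a) * g \<rho> = K * D powr (-a - 1/2)"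
      using a \<delta> by (simp add: g_def D_def powr_minus)
    also have "\<dots> \<le> g' \<rho>"
      unfolding g' using a nz norm_le K_le K by (intro mult_mono powr_mono2') auto
    finally show ?thesis .
  qed
  have "K * \<delta> powr (-2 * a) / (2 * a) * I \<le> integral {1 - Y * \<delta>..r} g'"
  proof (rule has_integral_le)
    show "((\<lambda>\<rho>. K * \<delta> powr (-2 * a) / (2 * a) * g \<rho>) has_integral
        K * \<delta> powr (-2 * a) / (2 * a) * I) {1 - Y * \<delta>..r}"
      by (rule has_integral_mult_right[OF I])
    show "(g' has_integral integral {1 - Y * \<delta>..r} g') {1 - Y * \<delta>..r}"
      by (intro integrable_integral integrable_continuous_interval continuous_on_subset[OF cont])
         (use \<delta> in auto)
  qed (rule lower)
  \<comment> \<open>The part of the ray before 1 - Y delta is discarded.\<close>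
  also have "\<dots> \<le> integral {0..r} g'"
    by (intro integral_subset_le integrable_continuous_interval continuous_on_subset[OF cont])
       (use \<delta> in \<open>auto simp: g'_def\<close>)
  finally have len: "K * \<delta> powr (-2 * a) / (2 * a) * I \<le> radial_length (koebe a) r \<theta>"
    by (simp add: g'_def[abs_def] radial_length_def)
  have inv: "r powr a * \<delta> powr (2 * a) \<le> inverse (norm (koebe a (rcis r \<theta>)))"
  proof -
    define z where "z = rcis r \<theta>"
    have "norm z < 1"
      unfolding z_def by (rule rcis_lt) (use r in auto)
    then have nz: "1 - z \<noteq> 0" by auto
    have "r * \<delta>\<^sup>2 \<le> (norm (1 - z))\<^sup>2"
      by (simp add: z_def norm_one_minus_rcis dist)
    then have "(r * \<delta>\<^sup>2) powr a \<le> ((norm (1 - z))\<^sup>2) powr a"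
      using r a by (intro powr_mono2) auto
    moreover have "(r * \<delta>\<^sup>2) powr a = r powr a * \<delta> powr (2 * a)"
      using r \<delta> by (simp add: powr_mult powr_powr flip: powr_numeral)
    moreover have "((norm (1 - z))\<^sup>2) powr a = norm (1 - z) powr (2 * a)"
      using nz by (simp add: powr_powr flip: powr_numeral)
    moreover have "norm (koebe a z) = r * norm (1 - z) powr (-2 * a)"
      unfolding koebe_def norm_mult norm_powr_of_real[OF nz] using r by (simp add: z_def)
    then have "inverse (norm (koebe a z)) = norm (1 - z) powr (2 * a) / r"
      by (simp add: powr_minus divide_inverse)
    moreover have "norm (1 - z) powr (2 * a) \<le> norm (1 - z) powr (2 * a) / r"
      using r by (simp add: le_divide_eq mult_left_le)
    ultimately show ?thesis by (simp add: z_def)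
  qed
  have "0 \<le> I"
    by (rule has_integral_nonneg[OF I]) (use a in \<open>simp add: g_def\<close>)
  then have "(r powr a * \<delta> powr (2 * a)) * (K * \<delta> powr (-2 * a) / (2 * a) * I)
      \<le> inverse (norm (koebe a (rcis r \<theta>))) * radial_length (koebe a) r \<theta>"
    using a K by (intro mult_mono inv len) auto
  moreover have "(r powr a * \<delta> powr (2 * a)) * (K * \<delta> powr (-2 * a) / (2 * a) * I)
      = (1 - \<delta> * sqrt (1 + Y\<^sup>2) / (2 * a)) * r powr a * I"
  proof -
    have "K / (2 * a) = 1 - \<delta> * sqrt (1 + Y\<^sup>2) / (2 * a)"
      using a by (simp add: K_def diff_divide_distrib)
    moreover have "\<delta> powr (2 * a) * \<delta> powr (-2 * a) = 1"
      using \<delta> by (simp add: powr_minus)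
    moreover have "(r powr a * \<delta> powr (2 * a)) * (K * \<delta> powr (-2 * a) / (2 * a) * I)
        = (K / (2 * a)) * r powr a * I * (\<delta> powr (2 * a) * \<delta> powr (-2 * a))"
      by (simp add: mult_ac)
    ultimately show ?thesis by simp
  qed
  ultimately show ?thesis by (simp add: I_def)
qed

text \<open>x^a F(x) tends to beta at 1 and to 0 at 0. Half of the gap beta - C is spent on choosing
  x near 1, the other half on choosing y near 0.\<close>

lemma starlike_beta_approx:
  assumes a: "0 < a" and C: "C < starlike_beta (1 - a)"
  obtains x y where "0 < y" "y < x" "x < 1" "C < x powr a * hyp a x - y powr a * hyp a y"
proof -
  define \<beta> where "\<beta> = starlike_beta (1 - a)"
  define e where "e = (\<beta> - C) / 2"
  have e: "0 < e" using C by (simp add: e_def \<beta>_def)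
  have "eventually (\<lambda>x. \<beta> - e < x powr a * hyp a x) (at_left 1)"
    by (rule order_tendstoD[OF powr_mult_hyp_tendsto[OF a]]) (use e in \<open>simp add: \<beta>_def\<close>)
  then have "eventually (\<lambda>x. x \<in> {0<..<1} \<and> \<beta> - e < x powr a * hyp a x) (at_left 1)"
    by (intro eventually_conj eventually_at_left_real) auto
  then obtain x where x: "0 < x" "x < 1" "\<beta> - e < x powr a * hyp a x"
    using eventually_happens'[OF trivial_limit_at_left_real] by auto
  have "((\<lambda>y. y powr a * \<beta>) \<longlongrightarrow> 0 powr a * \<beta>) (at_right 0)"
    by (intro tendsto_mult_right tendsto_powr' tendsto_ident_at tendsto_const)
       (use a in \<open>auto intro: eventually_mono[OF eventually_at_right_less]\<close>)
  then have "eventually (\<lambda>y. y powr a * \<beta> < e) (at_right 0)"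
    by (rule order_tendstoD) (use e in simp)
  then have "eventually (\<lambda>y. y \<in> {0<..<x} \<and> y powr a * \<beta> < e) (at_right 0)"
    by (intro eventually_conj eventually_at_right_real x)
  then obtain y where y: "0 < y" "y < x" "y powr a * \<beta> < e"
    using eventually_happens'[OF trivial_limit_at_right_real] by auto
  have "y powr a * hyp a y \<le> y powr a * \<beta>"
    unfolding \<beta>_def using x y by (intro mult_left_mono hyp_le_starlike_beta a) auto
  moreover have "C = \<beta> - e - e" by (simp add: e_def field_simps)
  ultimately show ?thesis using that[of y x] x y by linarith
qed

lemma starlike_beta_sharp:
  assumes \<alpha>: "0 \<le> \<alpha>" "\<alpha> < 1" and C: "C < starlike_beta \<alpha>"
  obtains f r \<theta> where "f \<in> starlike_of_order \<alpha>" "0 < r" "r < 1"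
    "C < inverse (norm (f (rcis r \<theta>))) * radial_length f r \<theta>"
proof -
  define a where "a = 1 - \<alpha>"
  have a: "0 < a" "a \<le> 1" using \<alpha> by (auto simp: a_def)
  have "C < starlike_beta (1 - a)" using C by (simp add: a_def)
  then obtain x y where xy: "0 < y" "y < x" "x < 1"
    and C_less: "C < x powr a * hyp a x - y powr a * hyp a y"
    by (rule starlike_beta_approx[OF a(1)])
  \<comment> \<open>Solves x = 1/(1 + eta^2), and likewise Y for y. Both are fixed before delta
    tends to 0, so that the correction factors tend to 1.\<close>
  define \<eta> where "\<eta> = sqrt (1 / x - 1)"
  define Y where "Y = sqrt (1 / y - 1)"
  have \<eta>: "0 < \<eta>" "\<eta> \<le> Y" and x: "1 / (1 + \<eta>\<^sup>2) = x" and y: "1 / (1 + Y\<^sup>2) = y"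
    using xy by (auto simp: \<eta>_def Y_def field_simps)
  define I where "I = x powr a * hyp a x - y powr a * hyp a y"
  have "((\<lambda>\<delta>. (1 - \<delta> * sqrt (1 + Y\<^sup>2) / (2 * a)) * (1 - \<eta> * \<delta>) powr a * I) \<longlongrightarrow> I) (at_right 0)"
    using a by (auto intro!: tendsto_eq_intros)
  then have ev: "eventually (\<lambda>\<delta>. C < (1 - \<delta> * sqrt (1 + Y\<^sup>2) / (2 * a)) * (1 - \<eta> * \<delta>) powr a * I) (at_right 0)"
    by (rule order_tendstoD) (use C_less in \<open>simp add: I_def\<close>)
  have small: "eventually (\<lambda>\<delta>. c * \<delta> < b) (at_right 0)" if "0 < b" for b c :: real
  proof (rule order_tendstoD)
    show "((\<lambda>\<delta>. c * \<delta>) \<longlongrightarrow> 0) (at_right 0)" by (auto intro!: tendsto_eq_intros)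
  qed (rule that)
  \<comment> \<open>The conditions on delta required by \<open>koebe_ray_lower_bound\<close>;
    \<open>1 * \<delta>\<close> is written so that \<open>small\<close> applies.\<close>
  have "eventually (\<lambda>\<delta>. C < (1 - \<delta> * sqrt (1 + Y\<^sup>2) / (2 * a)) * (1 - \<eta> * \<delta>) powr a * I
      \<and> 0 < \<delta> \<and> 1 * \<delta> < 2 \<and> Y * \<delta> < 1 \<and> sqrt (1 + Y\<^sup>2) * \<delta> < 2 * a) (at_right 0)"
    by (intro eventually_conj ev small eventually_at_right_less) (use a in auto)
  then obtain \<delta> where less: "C < (1 - \<delta> * sqrt (1 + Y\<^sup>2) / (2 * a)) * (1 - \<eta> * \<delta>) powr a * I"
    and \<delta>: "0 < \<delta>" "1 * \<delta> < 2" "Y * \<delta> < 1" "sqrt (1 + Y\<^sup>2) * \<delta> < 2 * a"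
    using eventually_happens'[OF trivial_limit_at_right_real] by blast
  define r where "r = 1 - \<eta> * \<delta>"
  have "0 < \<eta> * \<delta>" "\<eta> * \<delta> \<le> Y * \<delta>" using \<delta> \<eta> by auto
  then have r: "0 < r" "r < 1" using \<delta>(3) unfolding r_def by linarith+
  note less
  also have "(1 - \<delta> * sqrt (1 + Y\<^sup>2) / (2 * a)) * (1 - \<eta> * \<delta>) powr a * I
      \<le> inverse (norm (koebe a (rcis r (arccos (1 - \<delta>\<^sup>2 / 2)))))
        * radial_length (koebe a) r (arccos (1 - \<delta>\<^sup>2 / 2))"
    using koebe_ray_lower_bound[of a \<delta> Y \<eta>] a \<delta> \<eta>
    by (simp add: x y I_def r_def mult.commute[of _ "sqrt (1 + Y\<^sup>2)"])
  finally show ?thesis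
    using that koebe_starlike[OF \<alpha>] r by (simp add: a_def)
qed

theorem theorem1:
  fixes \<alpha> :: real
  assumes "0 \<le> \<alpha>" and "\<alpha> < 1"
  shows "(\<forall>f \<in> starlike_of_order \<alpha>. \<forall>r \<in> {0<..<1}. \<forall>\<theta>.
            inverse (norm (f (rcis r \<theta>))) * radial_length f r \<theta> \<le> starlike_beta \<alpha>)
       \<and> (\<forall>C < starlike_beta \<alpha>.
            \<not> (\<forall>f \<in> starlike_of_order \<alpha>. \<forall>r \<in> {0<..<1}. \<forall>\<theta>.
                  inverse (norm (f (rcis r \<theta>))) * radial_length f r \<theta> \<le> C))"
proof (intro conjI ballI allI impI notI)
  fix f r \<theta> assume f: "f \<in> starlike_of_order \<alpha>" and r: "r \<in> {0<..<1::real}"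
  \<comment> \<open>By injectivity f does not vanish at this point, so \<open>inverse\<close> is a
    true reciprocal and not the default value 0.\<close>
  have "f (rcis r \<theta>) \<noteq> f 0"
    using f r inj_onD[of f "ball 0 1" "rcis r \<theta>" 0]
    by (auto simp: starlike_of_order_def class_S_def)
  then have "0 < norm (f (rcis r \<theta>))"
    using f by (simp add: starlike_of_order_def class_S_def)
  then show "inverse (norm (f (rcis r \<theta>))) * radial_length f r \<theta> \<le> starlike_beta \<alpha>"
    using radial_length_le[OF assms f, of r \<theta>] r by (simp add: field_simps)
next
  fix C
  assume "C < starlike_beta \<alpha>"
    and le: "\<forall>f \<in> starlike_of_order \<alpha>. \<forall>r \<in> {0<..<1}. \<forall>\<theta>.
      inverse (norm (f (rcis r \<theta>))) * radial_length f r \<theta> \<le> C"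
  then obtain f r \<theta> where "f \<in> starlike_of_order \<alpha>" "0 < r" "r < 1"
      "C < inverse (norm (f (rcis r \<theta>))) * radial_length f r \<theta>"
    using starlike_beta_sharp[OF assms] by metis
  with le show False
    by (metis greaterThanLessThan_iff not_le)
qed

end
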